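(* Let $M$ be a smooth finite-dimensional manifold, $V,\tilde V$ Banach spaces, $\mathcal G=(\psi,U)$ a gauge on $M$, $\mathbf y=(y,y^\dagger)\in CRP_{\mathbf X}(M)$, $\boldsymbol\alpha=(\alpha,\alpha^\dagger)\in CRP_y^U(M,V)$ and $\mathbf f=(f,f^\dagger)\in CRP_{\mathbf X}(L(V,\tilde V))$. Let $$(\mathbf f\boldsymbol\alpha)_s:=\left(f_s\alpha_s,\;f_s^\dagger(I\otimes\alpha_s)+f_s\alpha_s^\dagger\right),$$ which is an element of $CRP_y^U(M,\tilde V)$, and let $\mathbf z=(z,z^\dagger)=\int\langle\boldsymbol\alpha,d\mathbf y^{\mathcal G}\rangle\in CRP_{\mathbf X}(V)$. Then, as elements of $CRP_{\mathbf X}(\tilde V)$, $$\int\langle\mathbf f,d\mathbf z\rangle=\int\langle\mathbf f\boldsymbol\alpha,d\mathbf y^{\mathcal G}\rangle.$$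
   Context: Rough paths. $W=\mathbb R^k$, $T>0$, $1\le p<3$, $\Delta_{[0,T]}=\{(s,t):0\le s\le t\le T\}$. A control is a continuous $\omega:\Delta_{[0,T]}\to[0,\infty)$ with $\omega(s,s)=0$ and $\omega(s,t)+\omega(t,u)\le\omega(s,u)$ for $s\le t\le u$. $\mathbf X=(x,\mathbb X)$ is a fixed weak-geometric $p$-rough path with control $\omega$: $x:[0,T]\to W$ and $\mathbb X:\Delta_{[0,T]}\to W\otimes W$ are continuous and, with $x_{s,t}:=x_t-x_s$, one has $\mathbb X_{s,u}=\mathbb X_{s,t}+\mathbb X_{t,u}+x_{s,t}\otimes x_{t,u}$ for $s\le t\le u$, $|x_{s,t}|\le\omega(s,t)^{1/p}$, $|\mathbb X_{s,t}|\le\omega(s,t)^{2/p}$, and the symmetric part of $\mathbb X_{s,t}$ equals $\frac12x_{s,t}\otimes x_{s,t}$. $F_{s,t}\approx_iG_{s,t}$ means: there are $C<\infty$, $\delta>0$ (with $\delta$ small enough that all expressions are defined) such that $|F_{s,t}-G_{s,t}|\le C\omega(s,t)^{i/p}$ for all $0\le s\le t\le T$ with $t-s\le\delta$; for values in spaces built from $T_{y_s}M$ the norm is the (operator) norm from any fixed Riemannian metric on $M$. $CRP_{\mathbf X}(V)$: continuous pairs $(z,z^\dagger)$, $z:[0,T]\to V$, $z^\dagger:[0,T]\to L(W,V)$, for which there is $C$ with $|z_t-z_s-z_s^\dagger x_{s,t}|\le C\omega(s,t)^{2/p}$ and $|z_t^\dagger-z_s^\dagger|\le C\omega(s,t)^{1/p}$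 for all $0\le s\le t\le T$. Flat integral. For $\mathbf z\in CRP_{\mathbf X}(V)$ and $\mathbf f\in CRP_{\mathbf X}(L(V,\tilde V))$, with $f_s^\dagger\in L(W,L(V,\tilde V))\cong L(W\otimes V,\tilde V)$, $\int\langle\mathbf f,d\mathbf z\rangle$ is the unique $(q,q^\dagger)\in CRP_{\mathbf X}(\tilde V)$ with $q_0=0$, $q_t-q_s\approx_3f_s(z_t-z_s)+f_s^\dagger(I\otimes z_s^\dagger)\mathbb X_{s,t}$, $q_s^\dagger=f_s\circ z_s^\dagger$. Gauges. A diagonal domain is an open $\mathcal D\subseteq M\times M$ containing the diagonal. A logarithm is a smooth $\psi:\mathcal D\to TM$ with $\psi(m,n)\in T_mM$, $\psi(m,m)=0_m$, and differential of $\psi(m,\cdot)$ at $m$ equal to the identity of $T_mM$. A parallelism is a smooth map $(n,m)\in\mathcal D\mapsto U(n,m)\in L(T_mM,T_nM)$ with $U(m,m)=I$. A gauge is a pair $(\psi,U)$ of these with common domain $\mathcal D$. $CRP_{\mathbf X}(M)$: continuous pairs $(y,y^\dagger)$, $y:[0,T]\to M$, $y_s^\dagger\in L(W,T_{y_s}M)$, with $\psi(y_s,y_t)\approx_2y_s^\dagger x_{s,t}$ and $U(y_s,y_t)y_t^\dagger\approx_1y_s^\dagger$ (this does not depend on the gauge chosen). $CRP_y^U(M,V)$: pairs $(\alpha,\alpha^\dagger)$ with $\alpha_s\in L(T_{y_s}M,V)$, $\alpha_s^\dagger\in L(W\otimes T_{y_s}M,V)$, $\alpha_t\circ U(y_t,y_s)-\alpha_s-\alpha_s^\dagger(x_{s,t}\otimes(\cdot))\approx_20$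 and $\alpha_t^\dagger\circ(I\otimes U(y_t,y_s))-\alpha_s^\dagger\approx_10$. Compatibility tensor. For parallelisms $\tilde U,U$: $S_m^{\tilde U,U}[v\otimes w]:=v\left[n\mapsto U(n,m)^{-1}\tilde U(n,m)w\right]$ (derivative at $m$ in direction $v$ of a $T_mM$-valued function), $v,w\in T_mM$. For a gauge $\mathcal G=(\psi,U)$: $S^{\mathcal G}:=S^{U^\psi,U}$ where $U^\psi(m,n):=$ differential of $\psi(m,\cdot)$ at $n$, viewed as a map $T_nM\to T_mM$. Integral on $M$. For $\boldsymbol\alpha\in CRP_y^U(M,V)$, $\int\langle\boldsymbol\alpha,d\mathbf y^{\mathcal G}\rangle$ is the unique $(z,z^\dagger)\in CRP_{\mathbf X}(V)$ with $z_0=0$, $z_s^\dagger=\alpha_s\circ y_s^\dagger$ and $z_t-z_s\approx_3\alpha_s\left(\psi(y_s,y_t)+S^{\mathcal G}_{y_s}((y_s^\dagger\otimes y_s^\dagger)\mathbb X_{s,t})\right)+\alpha_s^\dagger(I\otimes y_s^\dagger)\mathbb X_{s,t}$. *)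

theory Defs
  imports "HOL-Analysis.Analysis"
begin

section \<open>Smooth manifolds\<close>

text \<open>
  The model space \<open>'e\<close> ranges over \<open>{real_normed_vector,heine_borel}\<close>. By Riesz' theorem these are
  exactly the finite-dimensional normed spaces; unlike \<open>euclidean_space\<close> the sort also admits the
  zero space, so zero-dimensional manifolds are covered.

  On a finite-dimensional space, \<open>f\<close> is \<open>C^(n+1)\<close> on an open set iff it is differentiable there and
  each of its directional derivatives is \<open>C^n\<close>. Only open sets \<open>S\<close> are used below.
\<close>

primrec Ck_on ::
  "nat \<Rightarrow> 'a::real_normed_vector set \<Rightarrow> ('a \<Rightarrow> 'b::real_normed_vector) \<Rightarrow> bool" where
  "Ck_on 0 S f \<longleftrightarrow> continuous_on S f"
| "Ck_on (Suc n) S f \<longleftrightarrow>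
     (\<forall>a\<in>S. f differentiable (at a)) \<and> (\<forall>v. Ck_on n S (\<lambda>a. frechet_derivative f (at a) v))"

definition smooth_on ::
  "'a::real_normed_vector set \<Rightarrow> ('a \<Rightarrow> 'b::real_normed_vector) \<Rightarrow> bool" where
  "smooth_on S f \<longleftrightarrow> (\<forall>n. Ck_on n S f)"

datatype ('m, 'e) chart = Chart (cdom: "'m set") (cmap: "'m \<Rightarrow> 'e")

abbreviation crange :: "('m, 'e) chart \<Rightarrow> 'e set" where
  "crange c \<equiv> cmap c ` cdom c"

definition cinv :: "('m, 'e) chart \<Rightarrow> 'e \<Rightarrow> 'm" where
  "cinv c = inv_into (cdom c) (cmap c)"

text \<open>
  The underlying set of the manifold is the whole type \<open>'m\<close>; the Hausdorff and second countability
  axioms are the sort constraints on \<open>'m\<close>. The atlas need not be maximal.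
\<close>

definition smooth_atlas ::
  "('m::{t2_space,second_countable_topology}, 'e::{real_normed_vector,heine_borel}) chart set \<Rightarrow> bool" where
  "smooth_atlas A \<longleftrightarrow>
     (\<forall>c\<in>A. open (cdom c) \<and> open (crange c) \<and> homeomorphism (cdom c) (crange c) (cmap c) (cinv c)) \<and>
     (\<Union>c\<in>A. cdom c) = UNIV \<and>
     (\<forall>c\<in>A. \<forall>c'\<in>A. smooth_on (cmap c ` (cdom c \<inter> cdom c')) (cmap c' \<circ> cinv c))"

text \<open>
  Tangent spaces: \<open>T\<^sub>mM\<close> is represented by the model space \<open>'e\<close>, a vector being identified with its
  coordinates in the preferred chart \<open>chart_at A m\<close>. As the preferred chart jumps from point to
  point, continuity and smoothness of objects on the tangent bundle are always expressed through
  the charts \<open>c\<close> of the atlas, by means of the differential \<open>chart_diff A c m : T\<^sub>mM \<rightarrow> 'e\<close> of \<open>cmap c\<close>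
  at \<open>m\<close> and its inverse \<open>chart_diff_inv A c m\<close>.
\<close>

definition chart_at :: "('m, 'e) chart set \<Rightarrow> 'm \<Rightarrow> ('m, 'e) chart" where
  "chart_at A m = (SOME c. c \<in> A \<and> m \<in> cdom c)"

text \<open>\<open>tangent_deriv A h m v\<close> is \<open>v[h]\<close>, the derivative at \<open>m\<close> of the vector-valued function \<open>h\<close> in the
  direction \<open>v \<in> T\<^sub>mM\<close>; equivalently, the differential of \<open>h\<close> at \<open>m\<close> applied to \<open>v\<close>.\<close>

definition tangent_deriv ::
  "('m, 'e::real_normed_vector) chart set \<Rightarrow> ('m \<Rightarrow> 'b::real_normed_vector) \<Rightarrow> 'm \<Rightarrow> 'e \<Rightarrow> 'b" where
  "tangent_deriv A h m = frechet_derivative (h \<circ> cinv (chart_at A m)) (at (cmap (chart_at A m) m))"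

definition chart_diff ::
  "('m, 'e::real_normed_vector) chart set \<Rightarrow> ('m, 'e) chart \<Rightarrow> 'm \<Rightarrow> 'e \<Rightarrow>\<^sub>L 'e" where
  "chart_diff A c m = Blinfun (tangent_deriv A (cmap c) m)"

definition chart_diff_inv ::
  "('m, 'e::real_normed_vector) chart set \<Rightarrow> ('m, 'e) chart \<Rightarrow> 'm \<Rightarrow> 'e \<Rightarrow>\<^sub>L 'e" where
  "chart_diff_inv A c m =
     Blinfun (frechet_derivative (cmap (chart_at A m) \<circ> cinv c) (at (cmap c m)))"

definition riemannian_metric ::
  "('m, 'e::real_normed_vector) chart set \<Rightarrow> ('m \<Rightarrow> 'e \<Rightarrow> 'e \<Rightarrow> real) \<Rightarrow> bool" where
  "riemannian_metric A g \<longleftrightarrow>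
     (\<forall>m. bilinear (g m) \<and> (\<forall>v w. g m v w = g m w v) \<and> (\<forall>v. v \<noteq> 0 \<longrightarrow> g m v v > 0)) \<and>
     (\<forall>c\<in>A. smooth_on (crange c \<times> UNIV \<times> UNIV)
        (\<lambda>(a, v, w). g (cinv c a) (chart_diff_inv A c (cinv c a) v) (chart_diff_inv A c (cinv c a) w)))"

definition rnorm :: "('m \<Rightarrow> 'e \<Rightarrow> 'e \<Rightarrow> real) \<Rightarrow> 'm \<Rightarrow> 'e \<Rightarrow> real" where
  "rnorm g m v = sqrt (g m v v)"

text \<open>Operator norm of \<open>A\<close> with respect to given norms on its domain and its codomain.\<close>

definition op_norm :: "('a \<Rightarrow> real) \<Rightarrow> ('b \<Rightarrow> real) \<Rightarrow> ('a \<Rightarrow> 'b) \<Rightarrow> real" where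
  "op_norm N N' A = Sup {N' (A v) | v. N v \<le> 1}"


section \<open>Gauges\<close>

text \<open>
  A gauge \<open>(\<psi>, U)\<close> with its diagonal domain: \<open>glog G m n \<in> T\<^sub>mM\<close> is \<open>\<psi>(m,n)\<close>, and
  \<open>gpar G n m \<in> L(T\<^sub>mM, T\<^sub>nM)\<close> is \<open>U(n,m)\<close>. Values outside the domain are arbitrary.
\<close>

record (overloaded) ('m, 'e::real_normed_vector) gauge =
  gdom :: "('m \<times> 'm) set"
  glog :: "'m \<Rightarrow> 'm \<Rightarrow> 'e"
  gpar :: "'m \<Rightarrow> 'm \<Rightarrow> 'e \<Rightarrow>\<^sub>L 'e"

definition diagonal_domain :: "('m::topological_space \<times> 'm) set \<Rightarrow> bool" where
  "diagonal_domain D \<longleftrightarrow> open D \<and> (\<forall>m. (m, m) \<in> D)"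

text \<open>The part of \<open>D\<close> lying in \<open>cdom c \<times> cdom c'\<close>, in coordinates.\<close>

definition coord_dom ::
  "('m \<times> 'm) set \<Rightarrow> ('m, 'e) chart \<Rightarrow> ('m, 'e) chart \<Rightarrow> ('e \<times> 'e) set" where
  "coord_dom D c c' = {(a, b). a \<in> crange c \<and> b \<in> crange c' \<and> (cinv c a, cinv c' b) \<in> D}"

definition logarithm_on ::
  "('m, 'e::real_normed_vector) chart set \<Rightarrow> ('m \<times> 'm) set \<Rightarrow> ('m \<Rightarrow> 'm \<Rightarrow> 'e) \<Rightarrow> bool" where
  "logarithm_on A D \<psi> \<longleftrightarrow>
     (\<forall>c\<in>A. \<forall>c'\<in>A. smooth_on (coord_dom D c c')
        (\<lambda>(a, b). chart_diff A c (cinv c a) (\<psi> (cinv c a) (cinv c' b)))) \<and>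
     (\<forall>m. \<psi> m m = 0) \<and>
     (\<forall>m v. tangent_deriv A (\<psi> m) m v = v)"

definition parallelism_on ::
  "('m, 'e::real_normed_vector) chart set \<Rightarrow> ('m \<times> 'm) set \<Rightarrow> ('m \<Rightarrow> 'm \<Rightarrow> 'e \<Rightarrow>\<^sub>L 'e) \<Rightarrow> bool" where
  "parallelism_on A D U \<longleftrightarrow>
     (\<forall>c\<in>A. \<forall>c'\<in>A. smooth_on (coord_dom D c c')
        (\<lambda>(a, b). chart_diff A c (cinv c a) o\<^sub>L U (cinv c a) (cinv c' b) o\<^sub>L
                  chart_diff_inv A c' (cinv c' b))) \<and>
     (\<forall>m. U m m = id_blinfun)"

definition is_gauge ::
  "('m::topological_space, 'e::real_normed_vector) chart set \<Rightarrow> ('m, 'e) gauge \<Rightarrow> bool" where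
  "is_gauge A G \<longleftrightarrow>
     diagonal_domain (gdom G) \<and> logarithm_on A (gdom G) (glog G) \<and> parallelism_on A (gdom G) (gpar G)"

text \<open>\<open>compat_tensor A U' U m v w\<close> is \<open>S\<^sub>m[v \<otimes> w]\<close> for the pair of parallelisms \<open>(U', U)\<close>.\<close>

definition compat_tensor ::
  "('m, 'e::real_normed_vector) chart set \<Rightarrow> ('m \<Rightarrow> 'm \<Rightarrow> 'e \<Rightarrow>\<^sub>L 'e) \<Rightarrow> ('m \<Rightarrow> 'm \<Rightarrow> 'e \<Rightarrow>\<^sub>L 'e) \<Rightarrow>
   'm \<Rightarrow> 'e \<Rightarrow> 'e \<Rightarrow> 'e" where
  "compat_tensor A U' U m v w = tangent_deriv A (\<lambda>n. inv (blinfun_apply (U n m)) (U' n m w)) m v"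

definition log_parallelism ::
  "('m, 'e::real_normed_vector) chart set \<Rightarrow> ('m \<Rightarrow> 'm \<Rightarrow> 'e) \<Rightarrow> 'm \<Rightarrow> 'm \<Rightarrow> 'e \<Rightarrow>\<^sub>L 'e" where
  "log_parallelism A \<psi> m n = Blinfun (tangent_deriv A (\<psi> m) n)"

definition gauge_tensor ::
  "('m, 'e::real_normed_vector) chart set \<Rightarrow> ('m, 'e) gauge \<Rightarrow> 'm \<Rightarrow> 'e \<Rightarrow> 'e \<Rightarrow> 'e" where
  "gauge_tensor A G = compat_tensor A (log_parallelism A (glog G)) (gpar G)"


section \<open>Rough paths\<close>

text \<open>
  \<open>W = \<real>\<^sup>k\<close> is \<open>real^'k\<close> and \<open>W \<otimes> W\<close> is \<open>real^'k^'k\<close> with the Hilbert-Schmidt norm. Linear maps on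
  \<open>W \<otimes> E\<close> are kept in curried form, as elements of \<open>L(W, L(E, F))\<close>. \<open>tensor_eval B Z\<close> is the value at
  \<open>Z \<in> W \<otimes> W\<close> of the linear map induced by the bilinear map \<open>B\<close> on \<open>W \<times> W\<close>.
\<close>

definition tensor :: "real^'k \<Rightarrow> real^'k \<Rightarrow> real^'k^'k" where
  "tensor a b = (\<chi> i j. a $ i * b $ j)"

definition tensor_eval ::
  "(real^'k \<Rightarrow> real^'k \<Rightarrow> 'b::real_vector) \<Rightarrow> real^'k^'k \<Rightarrow> 'b" where
  "tensor_eval B Z = (\<Sum>i\<in>UNIV. \<Sum>j\<in>UNIV. (Z $ i $ j) *\<^sub>R B (axis i 1) (axis j 1))"

record 'k rough_path =
  rpT :: real
  rpp :: real
  rp\<omega> :: "real \<Rightarrow> real \<Rightarrow> real"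
  rpx :: "real \<Rightarrow> real^'k"
  rpX :: "real \<Rightarrow> real \<Rightarrow> real^'k^'k"

definition simplex2 :: "real \<Rightarrow> (real \<times> real) set" where
  "simplex2 T = {(s, t). 0 \<le> s \<and> s \<le> t \<and> t \<le> T}"

definition control :: "real \<Rightarrow> (real \<Rightarrow> real \<Rightarrow> real) \<Rightarrow> bool" where
  "control T \<omega> \<longleftrightarrow>
     continuous_on (simplex2 T) (\<lambda>(s, t). \<omega> s t) \<and>
     (\<forall>(s, t)\<in>simplex2 T. 0 \<le> \<omega> s t) \<and>
     (\<forall>s\<in>{0..T}. \<omega> s s = 0) \<and>
     (\<forall>s t u. 0 \<le> s \<and> s \<le> t \<and> t \<le> u \<and> u \<le> T \<longrightarrow> \<omega> s t + \<omega> t u \<le> \<omega> s u)"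

definition weak_geometric_rough_path :: "('k::finite) rough_path \<Rightarrow> bool" where
  "weak_geometric_rough_path X \<longleftrightarrow>
     (let T = rpT X; p = rpp X; \<omega> = rp\<omega> X; x = rpx X; XX = rpX X in
        T > 0 \<and> 1 \<le> p \<and> p < 3 \<and> control T \<omega> \<and>
        continuous_on {0..T} x \<and> continuous_on (simplex2 T) (\<lambda>(s, t). XX s t) \<and>
        (\<forall>s t u. 0 \<le> s \<and> s \<le> t \<and> t \<le> u \<and> u \<le> T \<longrightarrow>
           XX s u = XX s t + XX t u + tensor (x t - x s) (x u - x t)) \<and>
        (\<forall>(s, t)\<in>simplex2 T.
           norm (x t - x s) \<le> \<omega> s t powr (1 / p) \<and>
           norm (XX s t) \<le> \<omega> s t powr (2 / p) \<and>
           (1/2) *\<^sub>R (XX s t + transpose (XX s t)) = (1/2) *\<^sub>R tensor (x t - x s) (x t - x s)))"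

text \<open>
  \<open>approx X i ok N F E\<close> is \<open>F\<^sub>s\<^sub>,\<^sub>t \<approx>\<^sub>i E\<^sub>s\<^sub>,\<^sub>t\<close>, where \<open>N s\<close> is the norm in which the difference at \<open>(s,t)\<close>
  is measured, and \<open>ok s t\<close> says that the expressions are defined at \<open>(s,t)\<close>.
\<close>

definition approx ::
  "('k::finite) rough_path \<Rightarrow> real \<Rightarrow> (real \<Rightarrow> real \<Rightarrow> bool) \<Rightarrow> (real \<Rightarrow> 'a \<Rightarrow> real) \<Rightarrow>
   (real \<Rightarrow> real \<Rightarrow> 'a::minus) \<Rightarrow> (real \<Rightarrow> real \<Rightarrow> 'a) \<Rightarrow> bool" where
  "approx X i ok N F E \<longleftrightarrow>
     (\<exists>C \<delta>. \<delta> > 0 \<and> (\<forall>s t. 0 \<le> s \<and> s \<le> t \<and> t \<le> rpT X \<and> t - s \<le> \<delta> \<longrightarrow>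
        ok s t \<and> N s (F s t - E s t) \<le> C * rp\<omega> X s t powr (i / rpp X)))"


section \<open>Controlled rough paths\<close>

text \<open>
  Functions on \<open>[0,T]\<close> are extensional functions on the real line, so that equality of paths is
  equality on \<open>[0,T]\<close>.
\<close>

fun is_CRP :: "('k::finite) rough_path \<Rightarrow>
    (real \<Rightarrow> 'v::real_normed_vector) \<times> (real \<Rightarrow> (real^'k) \<Rightarrow>\<^sub>L 'v) \<Rightarrow> bool" where
  "is_CRP X (z, z') \<longleftrightarrow>
     z \<in> extensional {0..rpT X} \<and> z' \<in> extensional {0..rpT X} \<and>
     continuous_on {0..rpT X} z \<and> continuous_on {0..rpT X} z' \<and>
     (\<exists>C. \<forall>s t. 0 \<le> s \<and> s \<le> t \<and> t \<le> rpT X \<longrightarrow>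
        norm (z t - z s - z' s (rpx X t - rpx X s)) \<le> C * rp\<omega> X s t powr (2 / rpp X) \<and>
        norm (z' t - z' s) \<le> C * rp\<omega> X s t powr (1 / rpp X))"

definition CRP :: "('k::finite) rough_path \<Rightarrow>
    ((real \<Rightarrow> 'v::real_normed_vector) \<times> (real \<Rightarrow> (real^'k) \<Rightarrow>\<^sub>L 'v)) set" where
  "CRP X = {\<z>. is_CRP X \<z>}"

fun is_flat_integral :: "('k::finite) rough_path \<Rightarrow>
    (real \<Rightarrow> 'v::banach \<Rightarrow>\<^sub>L 'u::banach) \<times> (real \<Rightarrow> (real^'k) \<Rightarrow>\<^sub>L ('v \<Rightarrow>\<^sub>L 'u)) \<Rightarrow>
    (real \<Rightarrow> 'v) \<times> (real \<Rightarrow> (real^'k) \<Rightarrow>\<^sub>L 'v) \<Rightarrow>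
    (real \<Rightarrow> 'u) \<times> (real \<Rightarrow> (real^'k) \<Rightarrow>\<^sub>L 'u) \<Rightarrow> bool" where
  "is_flat_integral X (f, f') (z, z') (q, q') \<longleftrightarrow>
     (q, q') \<in> CRP X \<and> q 0 = 0 \<and>
     approx X 3 (\<lambda>s t. True) (\<lambda>s. norm)
       (\<lambda>s t. q t - q s)
       (\<lambda>s t. f s (z t - z s) + tensor_eval (\<lambda>a b. f' s a (z' s b)) (rpX X s t)) \<and>
     (\<forall>s\<in>{0..rpT X}. q' s = f s o\<^sub>L z' s)"

definition flat_integral :: "('k::finite) rough_path \<Rightarrow>
    (real \<Rightarrow> 'v::banach \<Rightarrow>\<^sub>L 'u::banach) \<times> (real \<Rightarrow> (real^'k) \<Rightarrow>\<^sub>L ('v \<Rightarrow>\<^sub>L 'u)) \<Rightarrow>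
    (real \<Rightarrow> 'v) \<times> (real \<Rightarrow> (real^'k) \<Rightarrow>\<^sub>L 'v) \<Rightarrow>
    (real \<Rightarrow> 'u) \<times> (real \<Rightarrow> (real^'k) \<Rightarrow>\<^sub>L 'u)" where
  "flat_integral X \<f> \<z> = (THE \<q>. is_flat_integral X \<f> \<z> \<q>)"

text \<open>Controlled rough paths on the manifold; \<open>y' s \<in> L(W, T\<^bsub>y s\<^esub>M)\<close>.\<close>

fun is_CRP_mfd :: "('k::finite) rough_path \<Rightarrow>
    ('m::topological_space, 'e::real_normed_vector) chart set \<Rightarrow> ('m \<Rightarrow> 'e \<Rightarrow> 'e \<Rightarrow> real) \<Rightarrow>
    ('m, 'e) gauge \<Rightarrow> (real \<Rightarrow> 'm) \<times> (real \<Rightarrow> (real^'k) \<Rightarrow>\<^sub>L 'e) \<Rightarrow> bool" where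
  "is_CRP_mfd X A g G (y, y') \<longleftrightarrow>
     y \<in> extensional {0..rpT X} \<and> y' \<in> extensional {0..rpT X} \<and>
     continuous_on {0..rpT X} y \<and>
     (\<forall>c\<in>A. continuous_on {s\<in>{0..rpT X}. y s \<in> cdom c} (\<lambda>s. chart_diff A c (y s) o\<^sub>L y' s)) \<and>
     approx X 2 (\<lambda>s t. (y s, y t) \<in> gdom G) (\<lambda>s. rnorm g (y s))
       (\<lambda>s t. glog G (y s) (y t)) (\<lambda>s t. y' s (rpx X t - rpx X s)) \<and>
     approx X 1 (\<lambda>s t. (y s, y t) \<in> gdom G)
       (\<lambda>s B. op_norm norm (rnorm g (y s)) (blinfun_apply B))
       (\<lambda>s t. gpar G (y s) (y t) o\<^sub>L y' t) (\<lambda>s t. y' s)"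

definition CRP_mfd :: "('k::finite) rough_path \<Rightarrow>
    ('m::topological_space, 'e::real_normed_vector) chart set \<Rightarrow> ('m \<Rightarrow> 'e \<Rightarrow> 'e \<Rightarrow> real) \<Rightarrow>
    ('m, 'e) gauge \<Rightarrow> ((real \<Rightarrow> 'm) \<times> (real \<Rightarrow> (real^'k) \<Rightarrow>\<^sub>L 'e)) set" where
  "CRP_mfd X A g G = {\<y>. is_CRP_mfd X A g G \<y>}"

text \<open>For \<open>B \<in> L(W \<otimes> E, F)\<close> in curried form, \<open>pre_comp B P = B \<circ> (I \<otimes> P)\<close> and
  \<open>post_comp Q B = Q \<circ> B\<close>.\<close>

definition pre_comp ::
  "('w::real_normed_vector \<Rightarrow>\<^sub>L ('b::real_normed_vector \<Rightarrow>\<^sub>L 'c::real_normed_vector)) \<Rightarrow>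
   ('a::real_normed_vector \<Rightarrow>\<^sub>L 'b) \<Rightarrow> ('w \<Rightarrow>\<^sub>L ('a \<Rightarrow>\<^sub>L 'c))" where
  "pre_comp B P = Blinfun (\<lambda>w. B w o\<^sub>L P)"

definition post_comp ::
  "('b::real_normed_vector \<Rightarrow>\<^sub>L 'c::real_normed_vector) \<Rightarrow>
   ('w::real_normed_vector \<Rightarrow>\<^sub>L ('a::real_normed_vector \<Rightarrow>\<^sub>L 'b)) \<Rightarrow> ('w \<Rightarrow>\<^sub>L ('a \<Rightarrow>\<^sub>L 'c))" where
  "post_comp Q B = Blinfun (\<lambda>w. Q o\<^sub>L B w)"

lemma pre_comp_apply [simp]: "pre_comp B P w = B w o\<^sub>L P"
  unfolding pre_comp_def
  by (subst bounded_linear_Blinfun_apply) (auto intro!: bounded_linear_intros)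

lemma post_comp_apply [simp]: "post_comp Q B w = Q o\<^sub>L B w"
  unfolding post_comp_def
  by (subst bounded_linear_Blinfun_apply) (auto intro!: bounded_linear_intros)

text \<open>One-forms along \<open>y\<close>: \<open>\<alpha> s \<in> L(T\<^bsub>y s\<^esub>M, V)\<close> and \<open>\<alpha>' s \<in> L(W \<otimes> T\<^bsub>y s\<^esub>M, V)\<close>. The norm on the
  latter space is the one of \<open>L(W, L(T\<^bsub>y s\<^esub>M, V))\<close>.\<close>

fun is_CRP_along :: "('k::finite) rough_path \<Rightarrow> ('m \<Rightarrow> 'e \<Rightarrow> 'e \<Rightarrow> real) \<Rightarrow>
    ('m, 'e::real_normed_vector) gauge \<Rightarrow> (real \<Rightarrow> 'm) \<Rightarrow>
    (real \<Rightarrow> 'e \<Rightarrow>\<^sub>L 'v::real_normed_vector) \<times> (real \<Rightarrow> (real^'k) \<Rightarrow>\<^sub>L ('e \<Rightarrow>\<^sub>L 'v)) \<Rightarrow> bool" where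
  "is_CRP_along X g G y (\<alpha>, \<alpha>') \<longleftrightarrow>
     \<alpha> \<in> extensional {0..rpT X} \<and> \<alpha>' \<in> extensional {0..rpT X} \<and>
     approx X 2 (\<lambda>s t. (y t, y s) \<in> gdom G)
       (\<lambda>s B. op_norm (rnorm g (y s)) norm (blinfun_apply B))
       (\<lambda>s t. (\<alpha> t o\<^sub>L gpar G (y t) (y s)) - \<alpha> s - \<alpha>' s (rpx X t - rpx X s)) (\<lambda>s t. 0) \<and>
     approx X 1 (\<lambda>s t. (y t, y s) \<in> gdom G)
       (\<lambda>s B. op_norm norm (\<lambda>C. op_norm (rnorm g (y s)) norm (blinfun_apply C)) (blinfun_apply B))
       (\<lambda>s t. pre_comp (\<alpha>' t) (gpar G (y t) (y s)) - \<alpha>' s) (\<lambda>s t. 0)"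

definition CRP_along :: "('k::finite) rough_path \<Rightarrow> ('m \<Rightarrow> 'e \<Rightarrow> 'e \<Rightarrow> real) \<Rightarrow>
    ('m, 'e::real_normed_vector) gauge \<Rightarrow> (real \<Rightarrow> 'm) \<Rightarrow>
    ((real \<Rightarrow> 'e \<Rightarrow>\<^sub>L 'v::real_normed_vector) \<times> (real \<Rightarrow> (real^'k) \<Rightarrow>\<^sub>L ('e \<Rightarrow>\<^sub>L 'v))) set" where
  "CRP_along X g G y = {\<a>. is_CRP_along X g G y \<a>}"

fun is_gauge_integral :: "('k::finite) rough_path \<Rightarrow>
    ('m, 'e::real_normed_vector) chart set \<Rightarrow> ('m, 'e) gauge \<Rightarrow>
    (real \<Rightarrow> 'm) \<times> (real \<Rightarrow> (real^'k) \<Rightarrow>\<^sub>L 'e) \<Rightarrow>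
    (real \<Rightarrow> 'e \<Rightarrow>\<^sub>L 'v::banach) \<times> (real \<Rightarrow> (real^'k) \<Rightarrow>\<^sub>L ('e \<Rightarrow>\<^sub>L 'v)) \<Rightarrow>
    (real \<Rightarrow> 'v) \<times> (real \<Rightarrow> (real^'k) \<Rightarrow>\<^sub>L 'v) \<Rightarrow> bool" where
  "is_gauge_integral X A G (y, y') (\<alpha>, \<alpha>') (z, z') \<longleftrightarrow>
     (z, z') \<in> CRP X \<and> z 0 = 0 \<and>
     (\<forall>s\<in>{0..rpT X}. z' s = \<alpha> s o\<^sub>L y' s) \<and>
     approx X 3 (\<lambda>s t. (y s, y t) \<in> gdom G) (\<lambda>s. norm)
       (\<lambda>s t. z t - z s)
       (\<lambda>s t. \<alpha> s (glog G (y s) (y t) +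
                    tensor_eval (\<lambda>a b. gauge_tensor A G (y s) (y' s a) (y' s b)) (rpX X s t)) +
              tensor_eval (\<lambda>a b. \<alpha>' s a (y' s b)) (rpX X s t))"

definition gauge_integral :: "('k::finite) rough_path \<Rightarrow>
    ('m, 'e::real_normed_vector) chart set \<Rightarrow> ('m, 'e) gauge \<Rightarrow>
    (real \<Rightarrow> 'm) \<times> (real \<Rightarrow> (real^'k) \<Rightarrow>\<^sub>L 'e) \<Rightarrow>
    (real \<Rightarrow> 'e \<Rightarrow>\<^sub>L 'v::banach) \<times> (real \<Rightarrow> (real^'k) \<Rightarrow>\<^sub>L ('e \<Rightarrow>\<^sub>L 'v)) \<Rightarrow>
    (real \<Rightarrow> 'v) \<times> (real \<Rightarrow> (real^'k) \<Rightarrow>\<^sub>L 'v)" where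
  "gauge_integral X A G \<y> \<a> = (THE \<z>. is_gauge_integral X A G \<y> \<a> \<z>)"

fun mult_along :: "('k::finite) rough_path \<Rightarrow>
    (real \<Rightarrow> 'v::real_normed_vector \<Rightarrow>\<^sub>L 'u::real_normed_vector) \<times>
      (real \<Rightarrow> (real^'k) \<Rightarrow>\<^sub>L ('v \<Rightarrow>\<^sub>L 'u)) \<Rightarrow>
    (real \<Rightarrow> 'e::real_normed_vector \<Rightarrow>\<^sub>L 'v) \<times> (real \<Rightarrow> (real^'k) \<Rightarrow>\<^sub>L ('e \<Rightarrow>\<^sub>L 'v)) \<Rightarrow>
    (real \<Rightarrow> 'e \<Rightarrow>\<^sub>L 'u) \<times> (real \<Rightarrow> (real^'k) \<Rightarrow>\<^sub>L ('e \<Rightarrow>\<^sub>L 'u))" where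
  "mult_along X (f, f') (\<alpha>, \<alpha>') =
     (\<lambda>s\<in>{0..rpT X}. f s o\<^sub>L \<alpha> s,
      \<lambda>s\<in>{0..rpT X}. pre_comp (f' s) (\<alpha> s) + post_comp (f s) (\<alpha>' s))"

end

theory Submission
  imports Defs
begin

text \<open>
  The defining expansion of the flat integral minus that of the gauge integral of \<open>f\<alpha>\<close> is \<open>f\<^sub>s\<close> applied
  to the error of the defining expansion of \<open>z\<close>, hence of order \<open>\<omega>\<^bsup>3/p\<^esup>\<close>: a path is one integral iff
  it is the other, whatever the compatibility tensor is. Existence of the flat integral is the sewing
  lemma. The remaining point, that \<open>f\<alpha>\<close> is controlled, needs \<open>\<alpha>\<close> and \<open>\<alpha>'\<close> to be bounded in the
  Riemannian norm; no continuity of them is assumed, but near each time they are transported by \<open>U\<close>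
  from one fixed later time, up to bounded errors.
\<close>

section \<open>Controls and sewing\<close>

text \<open>Transport is one-sided: \<open>U(y t, y s)\<close> carries the tangent space at the
  earlier time \<open>s\<close> to the one at the later time \<open>t\<close>, and its inverse is
  not at hand for a general pair. A bound can thus be pulled back from \<open>t\<close> to
  \<open>s\<close> but not pushed forward, so a neighbourhood of a time is controlled from a
  reference time to its right, possibly the endpoint \<open>T\<close>. The second obstacle is the
  norm: a tangent space is the model space read in a preferred chart that jumps from point to point,
  so the ambient norm may jump along the path. Bounds along \<open>y\<close> are therefore stated in
  the Riemannian norm, which is compared with coordinate norms on compact sets inside one fixed
  chart. Sewing and uniqueness both rest on \<open>3/p > 1\<close>. Existence and uniqueness of the
  gauge integral of \<open>f\<alpha>\<close> are inherited from the flat integral; no second sewing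
  takes place on the manifold.\<close>

lemma controlD:
  assumes "control T \<omega>"
  shows control_nonneg: "\<lbrakk>0 \<le> s; s \<le> t; t \<le> T\<rbrakk> \<Longrightarrow> 0 \<le> \<omega> s t"
    and control_refl: "\<lbrakk>0 \<le> s; s \<le> T\<rbrakk> \<Longrightarrow> \<omega> s s = 0"
    and control_superadditive: "\<lbrakk>0 \<le> s; s \<le> u; u \<le> t; t \<le> T\<rbrakk> \<Longrightarrow> \<omega> s u + \<omega> u t \<le> \<omega> s t"
  using assms by (auto simp: control_def simplex2_def)

lemma control_mono:
  assumes "control T \<omega>" "0 \<le> s'" "s' \<le> s" "s \<le> t" "t \<le> t'" "t' \<le> T"
  shows "\<omega> s t \<le> \<omega> s' t'"
  using control_superadditive[OF assms(1), of s' s t] control_superadditive[OF assms(1), of s' t t']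
    control_nonneg[OF assms(1), of s' s] control_nonneg[OF assms(1), of t t'] assms(2-)
  by linarith

lemma control_powr_mono:
  assumes "control T \<omega>" "0 \<le> s'" "s' \<le> s" "s \<le> t" "t \<le> t'" "t' \<le> T" "0 \<le> \<theta>"
  shows "\<omega> s t powr \<theta> \<le> \<omega> s' t' powr \<theta>"
  using control_mono[OF assms(1-6)] control_nonneg[OF assms(1), of s t] assms(2-)
  by (intro powr_mono2) auto

text \<open>Continuity on the compact simplex is uniform, and \<open>\<omega>\<close> vanishes on
  the diagonal.\<close>

lemma control_small:
  assumes "control T \<omega>" "0 < e"
  obtains \<delta> where "0 < \<delta>" "\<And>s t. \<lbrakk>0 \<le> s; s \<le> t; t \<le> T; t - s < \<delta>\<rbrakk> \<Longrightarrow> \<omega> s t < e"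
proof -
  have "simplex2 T = ({0..T} \<times> {0..T}) \<inter> {p. fst p \<le> snd p}"
    by (auto simp: simplex2_def)
  also have "compact \<dots>"
    by (intro compact_Int_closed compact_Times closed_Collect_le continuous_intros) auto
  finally have "uniformly_continuous_on (simplex2 T) (\<lambda>(s, t). \<omega> s t)"
    using assms(1) by (intro compact_uniformly_continuous) (auto simp: control_def)
  then obtain \<delta> where "\<delta> > 0" and \<delta>: "\<And>p q. \<lbrakk>p \<in> simplex2 T; q \<in> simplex2 T; dist q p < \<delta>\<rbrakk>
      \<Longrightarrow> dist ((\<lambda>(s, t). \<omega> s t) q) ((\<lambda>(s, t). \<omega> s t) p) < e"
    unfolding uniformly_continuous_on_def using assms(2) by metis
  show thesis
  proof (rule that[OF \<open>\<delta> > 0\<close>])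
    fix s t assume "0 \<le> s" "s \<le> t" "t \<le> T" "t - s < \<delta>"
    then show "\<omega> s t < e"
      using \<delta>[of "(s, s)" "(s, t)"] control_refl[OF assms(1), of s]
      by (auto simp: simplex2_def dist_Pair_Pair dist_real_def)
  qed
qed

lemma control_sum_le:
  fixes u :: "nat \<Rightarrow> real"
  assumes "control T \<omega>" "mono u" "0 \<le> u a" "a \<le> b" "u b \<le> T"
  shows "(\<Sum>i\<in>{a..<b}. \<omega> (u i) (u (Suc i))) \<le> \<omega> (u a) (u b)"
  using assms(4,5)
proof (induction b rule: dec_induct)
  case base
  then show ?case using control_refl[OF assms(1)] assms(3) by simp
next
  case (step n)
  have "u a \<le> u n" "u n \<le> u (Suc n)" using step assms(2) by (auto simp: mono_def)
  then show ?case
    using step control_superadditive[OF assms(1), of "u a" "u n" "u (Suc n)"] assms(3)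
    by (simp add: sum.atLeastLessThan_Suc)
qed

text \<open>Where \<open>\<omega> \<le> r\<close> one has \<open>\<omega> powr \<theta> \<le> r powr
  (\<theta> - 1) * \<omega>\<close>, and superadditivity bounds the sum of the
  \<open>\<omega>\<close> by the total over \<open>[0,T]\<close>. As \<open>\<theta> > 1\<close>,
  the prefactor is small for small \<open>r\<close>, uniformly over all partitions of small
  mesh.\<close>

lemma control_mesh:
  assumes "control T \<omega>" "1 < \<theta>" "0 < e" "0 \<le> T"
  shows "\<exists>\<delta>>0. \<forall>u a b. mono u \<longrightarrow> 0 \<le> u a \<longrightarrow> a \<le> b \<longrightarrow> u b \<le> T \<longrightarrow>
    (\<forall>i\<in>{a..<b}. u (Suc i) - u i < \<delta>) \<longrightarrow>
    (\<Sum>i\<in>{a..<b::nat}. \<omega> (u i) (u (Suc i)) powr \<theta>) \<le> e"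
proof -
  define W where "W = \<omega> 0 T + 1"
  have W: "\<omega> 0 T \<le> W" "W > 0" using control_nonneg[OF assms(1), of 0 T] assms(4) by (auto simp: W_def)
  \<comment> \<open>The solution of \<open>r powr (\<theta> - 1) * W = e\<close>; the summand 1 in
    \<open>W\<close> keeps the quotient meaningful when the control is zero.\<close>
  define r where "r = (e / W) powr (1 / (\<theta> - 1))"
  have r: "r > 0" "r powr (\<theta> - 1) * W = e" using W assms by (auto simp: r_def powr_powr)
  obtain \<delta> where \<delta>: "0 < \<delta>" "\<And>s t. \<lbrakk>0 \<le> s; s \<le> t; t \<le> T; t - s < \<delta>\<rbrakk> \<Longrightarrow> \<omega> s t < r"
    using control_small[OF assms(1) r(1)] by blast
  show ?thesis
  proof (intro exI[of _ \<delta>] conjI \<delta>(1) allI impI)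
    fix u :: "nat \<Rightarrow> real" and a b
    assume u: "mono u" "0 \<le> u a" "a \<le> b" "u b \<le> T" "\<forall>i\<in>{a..<b}. u (Suc i) - u i < \<delta>"
    have "(\<Sum>i\<in>{a..<b}. \<omega> (u i) (u (Suc i)) powr \<theta>)
        \<le> (\<Sum>i\<in>{a..<b}. r powr (\<theta> - 1) * \<omega> (u i) (u (Suc i)))"
    proof (rule sum_mono)
      fix i assume i: "i \<in> {a..<b}"
      have *: "0 \<le> u i" "u i \<le> u (Suc i)" "u (Suc i) \<le> T"
        using i u(2,4) monoD[OF u(1), of a i] monoD[OF u(1), of i "Suc i"] monoD[OF u(1), of "Suc i" b]
        by auto
      let ?w = "\<omega> (u i) (u (Suc i))"
      have w: "0 \<le> ?w" "?w \<le> r"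
        using control_nonneg[OF assms(1) *] \<delta>(2)[OF * bspec[OF u(5) i]] by auto
      have "?w powr \<theta> = ?w powr (\<theta> - 1) * ?w"
        using powr_add[of ?w "\<theta> - 1" 1] w by simp
      also have "\<dots> \<le> r powr (\<theta> - 1) * ?w"
        using w assms(2) by (intro mult_right_mono powr_mono2) auto
      finally show "?w powr \<theta> \<le> r powr (\<theta> - 1) * ?w" .
    qed
    also have "\<dots> \<le> r powr (\<theta> - 1) * \<omega> (u a) (u b)"
      unfolding sum_distrib_left[symmetric]
      by (intro mult_left_mono control_sum_le[OF assms(1)] u) auto
    also have "\<dots> \<le> r powr (\<theta> - 1) * W"
      using control_mono[OF assms(1), of 0 "u a" "u b" T] u(2-4) monoD[OF u(1), of a b] W(1)
      by (intro mult_left_mono) auto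
    also have "\<dots> = e" by (fact r(2))
    finally show "(\<Sum>i\<in>{a..<b}. \<omega> (u i) (u (Suc i)) powr \<theta>) \<le> e" .
  qed
qed

text \<open>
  Induction on the number of cells: cut out the cell across which \<open>\<omega>\<close> passes half of its total, so
  that each of the two remaining parts carries at most half, and \<open>2 \<cdot> 2\<^bsup>-\<theta>\<^esup> < 1\<close>.
\<close>

lemma partition_sum_bound:
  fixes \<Xi> :: "real \<Rightarrow> real \<Rightarrow> 'a::real_normed_vector" and u :: "nat \<Rightarrow> real"
  assumes \<omega>: "control T \<omega>" and \<theta>: "1 < \<theta>" and M: "0 \<le> M"
    and diag: "\<And>s. \<lbrakk>0 \<le> s; s \<le> T\<rbrakk> \<Longrightarrow> \<Xi> s s = 0"
    and defect: "\<And>s u t. \<lbrakk>0 \<le> s; s \<le> u; u \<le> t; t \<le> T\<rbrakk>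
      \<Longrightarrow> norm (\<Xi> s t - \<Xi> s u - \<Xi> u t) \<le> M * \<omega> s t powr \<theta>"
    and u: "mono u"
  shows "\<lbrakk>a \<le> b; 0 \<le> u a; u b \<le> T\<rbrakk>
    \<Longrightarrow> norm ((\<Sum>i\<in>{a..<b}. \<Xi> (u i) (u (Suc i))) - \<Xi> (u a) (u b))
       \<le> 2 * M / (1 - 2 powr (1 - \<theta>)) * \<omega> (u a) (u b) powr \<theta>"
proof (induction "b - a" arbitrary: a b rule: less_induct)
  case less
  \<comment> \<open>The fixed point of \<open>K = 2 * 2 powr (-\<theta>) * K + 2 * M\<close>: each
    of the two parts returns \<open>K * 2 powr (-\<theta>)\<close>, and the two defects cost
    \<open>M\<close> each.\<close>
  define K where "K = 2 * M / (1 - 2 powr (1 - \<theta>))"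
  have "2 powr (1 - \<theta>) < 2 powr (0::real)" using \<theta> by (intro powr_less_mono) auto
  then have c: "1 - 2 powr (1 - \<theta>) > 0" by simp
  then have "K * (1 - 2 powr (1 - \<theta>)) = 2 * M" "K \<ge> 0"
    using M c \<theta> by (simp_all add: K_def)
  then have K: "K \<ge> 0" "2 powr (1 - \<theta>) * K + 2 * M = K"
    by (auto simp: algebra_simps)
  show ?case
  proof (cases "a = b")
    case True
    then show ?thesis using diag less.prems control_refl[OF \<omega>] by simp
  next
    case False
    then have "a < b" using less.prems by simp
    have mono: "u i \<le> u j" if "i \<le> j" for i j using u that by (rule monoD)
    have \<omega>0: "0 \<le> \<omega> (u a) (u b)" using control_nonneg[OF \<omega>] less.prems mono by blast
    \<comment> \<open>The index \<open>k\<close> will be the last one up to which at most half of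
      the control is spent; \<open>a\<close> qualifies because \<open>\<omega>\<close> vanishes on
      the diagonal.\<close>
    define P where "P k \<longleftrightarrow> a \<le> k \<and> k < b \<and> 2 * \<omega> (u a) (u k) \<le> \<omega> (u a) (u b)" for k
    have "u a \<le> T" using mono[of a b] less.prems by linarith
    then have "P a" using \<open>a < b\<close> \<omega>0 less.prems control_refl[OF \<omega>, of "u a"] by (simp add: P_def)
    moreover have "\<And>k. P k \<Longrightarrow> k \<le> b" by (simp add: P_def)
    ultimately obtain k where k: "P k" and kmax: "\<And>j. P j \<Longrightarrow> j \<le> k"
      using ex_has_greatest_nat[of P a "\<lambda>k. k" b] by (metis GreatestI_nat Greatest_le_nat)
    have kab: "a \<le> k" "k < b" and left: "2 * \<omega> (u a) (u k) \<le> \<omega> (u a) (u b)" using k by (auto simp: P_def)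
    have ord: "0 \<le> u a" "u a \<le> u k" "u k \<le> u (Suc k)" "u (Suc k) \<le> u b" "u b \<le> T"
      using kab mono less.prems by auto
    \<comment> \<open>Either nothing is left beyond the cut cell, or \<open>Suc k\<close> violates
      \<open>P\<close> by maximality: then more than half lies before \<open>u (Suc k)\<close>, and
      superadditivity leaves less than half after it.\<close>
    have right: "2 * \<omega> (u (Suc k)) (u b) \<le> \<omega> (u a) (u b)"
    proof (cases "Suc k = b")
      case True
      then show ?thesis using \<omega>0 control_refl[OF \<omega>, of "u b"] ord by simp
    next
      case False
      then have "\<not> P (Suc k)" using kmax[of "Suc k"] by auto
      then have "2 * \<omega> (u a) (u (Suc k)) > \<omega> (u a) (u b)" using kab False by (auto simp: P_def)
      then show ?thesis using control_superadditive[OF \<omega>, of "u a" "u (Suc k)" "u b"] ord by linarith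
    qed
    let ?S = "\<lambda>a b. \<Sum>i\<in>{a..<b}. \<Xi> (u i) (u (Suc i))"
    have half: "K * w powr \<theta> \<le> K * (2 powr (- \<theta>) * \<omega> (u a) (u b) powr \<theta>)"
      if "0 \<le> w" "2 * w \<le> \<omega> (u a) (u b)" for w
    proof -
      have "w powr \<theta> \<le> (\<omega> (u a) (u b) / 2) powr \<theta>" using that \<theta> by (intro powr_mono2) auto
      also have "\<dots> = 2 powr (- \<theta>) * \<omega> (u a) (u b) powr \<theta>"
        using \<omega>0 by (simp add: powr_divide powr_minus divide_simps)
      finally show ?thesis using K by (intro mult_left_mono) auto
    qed
    have 1: "norm (?S a k - \<Xi> (u a) (u k)) \<le> K * (2 powr (- \<theta>) * \<omega> (u a) (u b) powr \<theta>)"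
      using less.hyps[of k a] kab ord half[OF _ left] control_nonneg[OF \<omega>, of "u a" "u k"]
      unfolding K_def by fastforce
    have 2: "norm (?S (Suc k) b - \<Xi> (u (Suc k)) (u b)) \<le> K * (2 powr (- \<theta>) * \<omega> (u a) (u b) powr \<theta>)"
      using less.hyps[of b "Suc k"] kab ord half[OF _ right] control_nonneg[OF \<omega>, of "u (Suc k)" "u b"]
      unfolding K_def by fastforce
    have 3: "norm (\<Xi> (u a) (u b) - \<Xi> (u a) (u k) - \<Xi> (u k) (u b)) \<le> M * \<omega> (u a) (u b) powr \<theta>"
      using ord by (intro defect) auto
    have "norm (\<Xi> (u k) (u b) - \<Xi> (u k) (u (Suc k)) - \<Xi> (u (Suc k)) (u b)) \<le> M * \<omega> (u k) (u b) powr \<theta>"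
      using ord by (intro defect) auto
    also have "\<dots> \<le> M * \<omega> (u a) (u b) powr \<theta>"
      using ord M \<theta> by (intro mult_left_mono control_powr_mono[OF \<omega>]) auto
    finally have 4: "norm (\<Xi> (u k) (u b) - \<Xi> (u k) (u (Suc k)) - \<Xi> (u (Suc k)) (u b))
      \<le> M * \<omega> (u a) (u b) powr \<theta>" .
    have "?S k b = \<Xi> (u k) (u (Suc k)) + ?S (Suc k) b"
      using kab by (intro sum.atLeast_Suc_lessThan) auto
    then have "?S a b = ?S a k + \<Xi> (u k) (u (Suc k)) + ?S (Suc k) b"
      using kab sum.atLeastLessThan_concat[of a k b "\<lambda>i. \<Xi> (u i) (u (Suc i))"]
      by (simp add: add.assoc)
    \<comment> \<open>Two points are inserted, \<open>u k\<close> into \<open>[u a, u b]\<close> and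
      then \<open>u (Suc k)\<close> into \<open>[u k, u b]\<close>; the cut cell itself enters the
      sum without error.\<close>
    then have "?S a b - \<Xi> (u a) (u b) = (?S a k - \<Xi> (u a) (u k)) + (?S (Suc k) b - \<Xi> (u (Suc k)) (u b))
        - (\<Xi> (u a) (u b) - \<Xi> (u a) (u k) - \<Xi> (u k) (u b))
        - (\<Xi> (u k) (u b) - \<Xi> (u k) (u (Suc k)) - \<Xi> (u (Suc k)) (u b))"
      by simp
    also have "norm \<dots> \<le> K * (2 powr (- \<theta>) * \<omega> (u a) (u b) powr \<theta>) + K * (2 powr (- \<theta>) * \<omega> (u a) (u b) powr \<theta>)
        + M * \<omega> (u a) (u b) powr \<theta> + M * \<omega> (u a) (u b) powr \<theta>"
      by (intro order_trans[OF norm_triangle_ineq4] order_trans[OF norm_triangle_ineq] add_mono 1 2 3 4)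
    also have "\<dots> = (2 powr (1 - \<theta>) * K + 2 * M) * \<omega> (u a) (u b) powr \<theta>"
      by (simp add: powr_diff powr_minus field_simps)
    finally show ?thesis unfolding K(2) unfolding K_def .
  qed
qed

text \<open>\<open>J t\<close> is the limit of the sums of \<open>\<Xi>\<close> over uniform grids
  clipped at \<open>t\<close>. Two grids are compared through their common refinement, at a cost of
  \<open>K\<close> times a sum of \<open>\<omega> powr \<theta>\<close> over cells, which vanishes
  with the mesh. The estimate for \<open>J t - J s\<close> survives the limit because the failure of
  additivity of the grid sums also vanishes with the mesh.\<close>

lemma sewing:
  fixes \<Xi> :: "real \<Rightarrow> real \<Rightarrow> 'a::banach"
  assumes \<omega>: "control T \<omega>" and \<theta>: "1 < \<theta>" and M: "0 \<le> M" and T: "0 < T"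
    and diag: "\<And>s. \<lbrakk>0 \<le> s; s \<le> T\<rbrakk> \<Longrightarrow> \<Xi> s s = 0"
    and defect: "\<And>s u t. \<lbrakk>0 \<le> s; s \<le> u; u \<le> t; t \<le> T\<rbrakk>
      \<Longrightarrow> norm (\<Xi> s t - \<Xi> s u - \<Xi> u t) \<le> M * \<omega> s t powr \<theta>"
  obtains J K where "J 0 = 0" "0 \<le> K"
    "\<And>s t. \<lbrakk>0 \<le> s; s \<le> t; t \<le> T\<rbrakk> \<Longrightarrow> norm (J t - J s - \<Xi> s t) \<le> K * \<omega> s t powr \<theta>"
proof -
  define K where "K = 2 * M / (1 - 2 powr (1 - \<theta>))"
  have "2 powr (1 - \<theta>) < 2 powr (0::real)" using \<theta> by (intro powr_less_mono) auto
  then have K0: "K \<ge> 0" using M by (auto simp: K_def)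
  note bound = partition_sum_bound[OF \<omega> \<theta> M diag defect, folded K_def]
  define G where "G N i = T * real i / real N" for N i :: nat
  define Q where "Q N t = (\<Sum>i\<in>{0..<N}. \<Xi> (min (G N i) t) (min (G N (Suc i)) t))" for N t
  have Gmono: "mono (G N)" for N
    using T by (auto simp: G_def mono_def intro!: divide_right_mono mult_left_mono)
  have mmono: "mono (\<lambda>i. min (G N i) t)" for N t
    using Gmono[of N] by (auto simp: mono_def min_def) (meson dual_order.trans)+
  have G0: "G N 0 = 0" "0 \<le> G N i" for N i using T by (auto simp: G_def)
  have GN: "G N N = T" if "N > 0" for N using that by (simp add: G_def)
  \<comment> \<open>Clipping one fixed grid of \<open>[0,T]\<close> at \<open>t\<close> makes \<open>Q N\<close> additive up to the defect at a single cell.\<close>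
  have mesh: "\<exists>n0>0. \<forall>N\<ge>n0. \<forall>t. 0 \<le> t \<and> t \<le> T \<longrightarrow>
      (\<Sum>i\<in>{0..<N}. \<omega> (min (G N i) t) (min (G N (Suc i)) t) powr \<theta>) \<le> e" if "e > 0" for e
  proof -
    obtain \<delta> where \<delta>: "0 < \<delta>"
      "\<forall>u a b. mono u \<longrightarrow> 0 \<le> u a \<longrightarrow> a \<le> b \<longrightarrow> u b \<le> T \<longrightarrow>
        (\<forall>i\<in>{a..<b}. u (Suc i) - u i < \<delta>) \<longrightarrow>
        (\<Sum>i\<in>{a..<b::nat}. \<omega> (u i) (u (Suc i)) powr \<theta>) \<le> e"
      using control_mesh[OF \<omega> \<theta> \<open>e > 0\<close> less_imp_le[OF T]] by blast
    obtain n0 :: nat where n0': "T / \<delta> < real n0" using reals_Archimedean2 by blast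
    have "0 < T / \<delta>" using \<delta>(1) T by simp
    then have n0: "n0 > 0" "T / \<delta> < real n0" using n0' by (auto intro: gr0I)
    have "(\<Sum>i\<in>{0..<N}. \<omega> (min (G N i) t) (min (G N (Suc i)) t) powr \<theta>) \<le> e"
      if "N \<ge> n0" "0 \<le> t" "t \<le> T" for N t
    proof (rule \<delta>(2)[rule_format])
      fix i assume "i \<in> {0..<N}"
      have "G N (Suc i) - G N i = T / real N"
        by (simp add: G_def add_divide_distrib distrib_left)
      also have "\<dots> < \<delta>"
      proof -
        have "T < \<delta> * real n0" using n0 \<delta>(1) by (simp add: field_simps)
        also have "\<dots> \<le> \<delta> * real N" using that \<delta>(1) by simp
        finally show ?thesis using n0 that by (simp add: field_simps)
      qed
      finally show "min (G N (Suc i)) t - min (G N i) t < \<delta>" using \<delta>(1) by (auto simp: min_def)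
    qed (use that mmono G0 in auto)
    then show ?thesis using n0 by blast
  qed
  \<comment> \<open>Every cell of the coarse grid is split into \<open>L\<close> cells of the fine
    one, and the partition bound is applied cell by cell.\<close>
  have refine: "norm (Q (N * L) t - Q N t)
      \<le> K * (\<Sum>i\<in>{0..<N}. \<omega> (min (G N i) t) (min (G N (Suc i)) t) powr \<theta>)"
    if "N > 0" "L > 0" "0 \<le> t" "t \<le> T" for N L t
  proof -
    let ?u = "\<lambda>i. min (G (N * L) i) t"
    have G1: "G (N * L) (i * L) = G N i" for i
      using that by (simp add: G_def)
    have G2: "G (N * L) (i * L + L) = G N (Suc i)" for i
      using G1[of "Suc i"] by (simp add: add.commute)
    note G = G1 G2
    have "Q (N * L) t = (\<Sum>i\<in>{0..<N}. \<Sum>j\<in>{i * L..<i * L + L}. \<Xi> (?u j) (?u (Suc j)))"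
      unfolding Q_def using sum.nat_group[of "\<lambda>j. \<Xi> (?u j) (?u (Suc j))" L N]
      by (simp add: lessThan_atLeast0)
    then have eq: "Q (N * L) t - Q N t = (\<Sum>i\<in>{0..<N}. (\<Sum>j\<in>{i * L..<i * L + L}. \<Xi> (?u j) (?u (Suc j)))
        - \<Xi> (?u (i * L)) (?u (i * L + L)))"
      by (simp add: Q_def sum_subtractf G)
    have "norm (Q (N * L) t - Q N t) \<le> (\<Sum>i\<in>{0..<N}. K * \<omega> (?u (i * L)) (?u (i * L + L)) powr \<theta>)"
      unfolding eq
    proof (rule sum_norm_le)
      fix i
      have "0 \<le> ?u (i * L)" "?u (i * L + L) \<le> T" using that G0(2)[of "N * L" "i * L"] by linarith+
      then show "norm ((\<Sum>j\<in>{i * L..<i * L + L}. \<Xi> (?u j) (?u (Suc j))) - \<Xi> (?u (i * L)) (?u (i * L + L)))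
          \<le> K * \<omega> (?u (i * L)) (?u (i * L + L)) powr \<theta>"
        by (intro bound[of ?u "i * L" "i * L + L"] mmono) auto
    qed
    also have "\<dots> = K * (\<Sum>i\<in>{0..<N}. \<omega> (min (G N i) t) (min (G N (Suc i)) t) powr \<theta>)"
      unfolding G1 G2 by (rule sum_distrib_left[symmetric])
    finally show ?thesis .
  qed
  have lim: "\<exists>l. (\<lambda>N. Q N t) \<longlonglongrightarrow> l" if t: "0 \<le> t" "t \<le> T" for t
  proof -
    have "Cauchy (\<lambda>N. Q N t)"
    proof (rule metric_CauchyI)
      fix e :: real assume "e > 0"
      then have "e / (4 * (K + 1)) > 0" using K0 by simp
      then obtain n0 where n0: "n0 > 0" "\<forall>N\<ge>n0. \<forall>t. 0 \<le> t \<and> t \<le> T \<longrightarrow>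
          (\<Sum>i\<in>{0..<N}. \<omega> (min (G N i) t) (min (G N (Suc i)) t) powr \<theta>) \<le> e / (4 * (K + 1))"
        using mesh by meson
      \<comment> \<open>Used twice, with the roles of \<open>N\<close> and \<open>L\<close>
        exchanged, since \<open>N * L\<close> refines both grids.\<close>
      have *: "norm (Q (N * L) t - Q N t) \<le> e / 4" if "N \<ge> n0" "L \<ge> n0" for N L
      proof -
        have "norm (Q (N * L) t - Q N t) \<le> K * (e / (4 * (K + 1)))"
          using that n0 t by (intro order_trans[OF refine] mult_left_mono K0) auto
        also have "\<dots> \<le> e / 4" using K0 \<open>e > 0\<close> by (simp add: field_simps)
        finally show ?thesis .
      qed
      have "dist (Q N t) (Q L t) < e" if "N \<ge> n0" "L \<ge> n0" for N L
        using *[OF that] *[OF that(2,1)] norm_triangle_ineq4[of "Q (N * L) t - Q L t" "Q (N * L) t - Q N t"] \<open>e > 0\<close>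
        by (simp add: dist_norm mult.commute)
      then show "\<exists>n. \<forall>m\<ge>n. \<forall>k\<ge>n. dist (Q m t) (Q k t) < e" by blast
    qed
    then show ?thesis using Cauchy_convergent convergent_def by blast
  qed
  define J where "J t = lim (\<lambda>N. Q N t)" for t
  have J: "(\<lambda>N. Q N t) \<longlonglongrightarrow> J t" if "0 \<le> t" "t \<le> T" for t
    using lim[OF that] by (simp add: J_def lim_def[symmetric] convergent_LIMSEQ_iff[symmetric] convergent_def)
  have "Q N 0 = 0" for N
    unfolding Q_def using diag[of 0] T G0 by (intro sum.neutral) (simp add: min_absorb2)
  then have J0: "J 0 = 0" using J[of 0] T by (simp add: LIMSEQ_const_iff)
  have "norm (J t - J s - \<Xi> s t) \<le> K * \<omega> s t powr \<theta>" if st: "0 \<le> s" "s \<le> t" "t \<le> T" for s t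
  proof (rule field_le_epsilon)
    fix e :: real assume "e > 0"
    then have "e / (M + 1) > 0" using M by simp
    then obtain n0 where n0: "n0 > 0" "\<forall>N\<ge>n0. \<forall>t. 0 \<le> t \<and> t \<le> T \<longrightarrow>
        (\<Sum>i\<in>{0..<N}. \<omega> (min (G N i) t) (min (G N (Suc i)) t) powr \<theta>) \<le> e / (M + 1)"
      using mesh by meson
    have "norm (Q N t - Q N s - \<Xi> s t) \<le> K * \<omega> s t powr \<theta> + e" if N: "N \<ge> n0" for N
    proof -
      \<comment> \<open>The grid clipped from both sides is a partition of \<open>[s,t]\<close> with
        exact endpoints, so the partition bound applies to it directly.\<close>
      let ?u = "\<lambda>i. max s (min t (G N i))"
      let ?S = "\<Sum>i\<in>{0..<N}. \<Xi> (?u i) (?u (Suc i))"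
      have u: "mono ?u" "?u 0 = s" "?u N = t"
        using Gmono[of N] st GN[of N] N n0
        by (auto simp: mono_def G0 min_def max_def) (meson dual_order.trans linear)+
      have "norm (?S - \<Xi> s t) \<le> K * \<omega> s t powr \<theta>"
        using bound[of ?u 0 N] u st by simp
      moreover have "norm (Q N t - Q N s - ?S) \<le> e"
      proof -
        have eq: "Q N t - Q N s - ?S = (\<Sum>i\<in>{0..<N}. \<Xi> (min (G N i) t) (min (G N (Suc i)) t)
            - \<Xi> (min (G N i) s) (min (G N (Suc i)) s) - \<Xi> (?u i) (?u (Suc i)))"
          by (simp add: Q_def sum_subtractf)
        have "norm (Q N t - Q N s - ?S) \<le> (\<Sum>i\<in>{0..<N}. M * \<omega> (min (G N i) t) (min (G N (Suc i)) t) powr \<theta>)"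
          unfolding eq
        proof (rule sum_norm_le)
          fix i
          define a b where "a = G N i" and "b = G N (Suc i)"
          have ab: "0 \<le> a" "a \<le> b" using G0 monoD[OF Gmono, of i "Suc i"] by (auto simp: a_def b_def)
          have nn: "0 \<le> M * \<omega> (min a t) (min b t) powr \<theta>" using M by simp
          \<comment> \<open>A cell on either side of \<open>s\<close> contributes zero, because its
            clipped pieces coincide or collapse to a point; only a cell straddling \<open>s\<close>
            produces a defect.\<close>
          consider "b \<le> s" | "s \<le> a" | "a < s" "s < b" by linarith
          then have "norm (\<Xi> (min a t) (min b t) - \<Xi> (min a s) (min b s)
              - \<Xi> (max s (min t a)) (max s (min t b))) \<le> M * \<omega> (min a t) (min b t) powr \<theta>"
          proof cases
            case 1
            then have "min a t = a" "min b t = b" "min a s = a" "min b s = b"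
              "max s (min t a) = s" "max s (min t b) = s" using ab st by auto
            then show ?thesis using nn diag[of s] st by simp
          next
            case 2
            then have "min a s = s" "min b s = s"
              "max s (min t a) = min a t" "max s (min t b) = min b t" using ab st by auto
            then show ?thesis using nn diag[of s] st by simp
          next
            case 3
            then have "min a t = a" "min a s = a" "min b s = s"
              "max s (min t a) = s" "max s (min t b) = min b t" using ab st by auto
            then show ?thesis using defect[of a s "min b t"] 3 ab st by simp
          qed
          then show "norm (\<Xi> (min (G N i) t) (min (G N (Suc i)) t)
            - \<Xi> (min (G N i) s) (min (G N (Suc i)) s) - \<Xi> (?u i) (?u (Suc i)))
            \<le> M * \<omega> (min (G N i) t) (min (G N (Suc i)) t) powr \<theta>"
            by (simp add: a_def b_def)
        qed
        also have "\<dots> \<le> M * (e / (M + 1))"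
          unfolding sum_distrib_left[symmetric] using n0 N st M by (intro mult_left_mono) auto
        also have "\<dots> \<le> e" using M \<open>e > 0\<close> by (simp add: field_simps)
        finally show ?thesis .
      qed
      ultimately show ?thesis
        using norm_triangle_ineq[of "Q N t - Q N s - ?S" "?S - \<Xi> s t"] by simp
    qed
    then have "eventually (\<lambda>N. norm (Q N t - Q N s - \<Xi> s t) \<le> K * \<omega> s t powr \<theta> + e) sequentially"
      by (auto simp: eventually_sequentially)
    moreover have "(\<lambda>N. norm (Q N t - Q N s - \<Xi> s t)) \<longlonglongrightarrow> norm (J t - J s - \<Xi> s t)"
      using st by (intro tendsto_intros J) auto
    ultimately show "norm (J t - J s - \<Xi> s t) \<le> K * \<omega> s t powr \<theta> + e"
      by (intro tendsto_upperbound) auto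
  qed
  with J0 K0 show thesis using that by blast
qed

text \<open>Telescoping over a uniform partition of \<open>[0,t]\<close> bounds \<open>d t\<close>
  by a multiple of a sum of \<open>\<omega> powr \<theta>\<close>, which is as small as desired.
  This is the uniqueness half of sewing.\<close>

lemma small_increments_imp_zero:
  fixes d :: "real \<Rightarrow> 'a::real_normed_vector"
  assumes \<omega>: "control T \<omega>" and \<theta>: "1 < \<theta>" and d0: "d 0 = 0" and "0 < \<delta>"
    and inc: "\<And>s t. \<lbrakk>0 \<le> s; s \<le> t; t \<le> T; t - s \<le> \<delta>\<rbrakk> \<Longrightarrow> norm (d t - d s) \<le> C * \<omega> s t powr \<theta>"
    and t: "0 \<le> t" "t \<le> T"
  shows "d t = 0"
proof -
  have "norm (d t) \<le> 0 + e" if "e > 0" for e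
  proof -
    have e: "e / (\<bar>C\<bar> + 1) > 0" using that by simp
    have T: "0 \<le> T" using t by simp
    obtain \<delta>' where \<delta>': "0 < \<delta>'"
      "\<forall>u a b. mono u \<longrightarrow> 0 \<le> u a \<longrightarrow> a \<le> b \<longrightarrow> u b \<le> T \<longrightarrow>
        (\<forall>i\<in>{a..<b}. u (Suc i) - u i < \<delta>') \<longrightarrow>
        (\<Sum>i\<in>{a..<b::nat}. \<omega> (u i) (u (Suc i)) powr \<theta>) \<le> e / (\<bar>C\<bar> + 1)"
      using control_mesh[OF \<omega> \<theta> e T] by blast
    \<comment> \<open>Steps must be short both for the increment estimate and for the mesh
      estimate.\<close>
    define r where "r = min \<delta> \<delta>'"
    have r: "r > 0" using \<open>0 < \<delta>\<close> \<delta>' by (simp add: r_def)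
    obtain N :: nat where N: "t / r < real N" using reals_Archimedean2 by blast
    moreover have "0 \<le> t / r" using t r by simp
    ultimately have N0: "real N > 0" by linarith
    define u where "u i = t * real i / real N" for i
    have step: "u (Suc i) - u i < r" for i
    proof -
      have "u (Suc i) - u i = t / real N" by (simp add: u_def add_divide_distrib distrib_left)
      also have "\<dots> < r" using N N0 r by (simp add: field_simps)
      finally show ?thesis .
    qed
    have u: "mono u" "u 0 = 0" "u N = t"
      using t N0 by (auto simp: u_def mono_def intro!: divide_right_mono mult_left_mono)
    have "d t = (\<Sum>i\<in>{0..<N}. d (u (Suc i)) - d (u i))"
      using sum_Suc_diff'[of 0 N "\<lambda>i. d (u i)"] u d0 by simp
    also have "norm \<dots> \<le> (\<Sum>i\<in>{0..<N}. \<bar>C\<bar> * \<omega> (u i) (u (Suc i)) powr \<theta>)"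
    proof (rule sum_norm_le)
      fix i assume "i \<in> {0..<N}"
      then have "norm (d (u (Suc i)) - d (u i)) \<le> C * \<omega> (u i) (u (Suc i)) powr \<theta>"
        using monoD[OF u(1), of 0 i] monoD[OF u(1), of i "Suc i"] monoD[OF u(1), of "Suc i" N] u t step[of i]
        by (intro inc) (auto simp: r_def)
      also have "\<dots> \<le> \<bar>C\<bar> * \<omega> (u i) (u (Suc i)) powr \<theta>" by (intro mult_right_mono) auto
      finally show "norm (d (u (Suc i)) - d (u i)) \<le> \<bar>C\<bar> * \<omega> (u i) (u (Suc i)) powr \<theta>" .
    qed
    also have "\<dots> \<le> \<bar>C\<bar> * (e / (\<bar>C\<bar> + 1))"
      unfolding sum_distrib_left[symmetric]
    proof (intro mult_left_mono \<delta>'(2)[rule_format])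
      show "u (Suc i) - u i < \<delta>'" for i using step[of i] by (simp add: r_def)
    qed (use u t in auto)
    also have "\<dots> \<le> e" using that by (simp add: field_simps)
    finally show ?thesis by simp
  qed
  then have "norm (d t) \<le> 0" by (rule field_le_epsilon)
  then show ?thesis by simp
qed

section \<open>The flat integral\<close>

lemma tensor_eval_add: "tensor_eval B (Y + Z) = tensor_eval B Y + tensor_eval B Z"
  by (simp add: tensor_eval_def scaleR_add_left sum.distrib)

lemma tensor_eval_fun_add:
  "tensor_eval (\<lambda>a b. B a b + B' a b) Z = tensor_eval B Z + tensor_eval B' Z"
  by (simp add: tensor_eval_def scaleR_add_right sum.distrib)

lemma tensor_eval_fun_diff:
  "tensor_eval (\<lambda>a b. B a b - B' a b) Z = tensor_eval B Z - tensor_eval B' Z"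
  by (simp add: tensor_eval_def scaleR_diff_right sum_subtractf)

lemma tensor_eval_linear:
  "linear L \<Longrightarrow> L (tensor_eval B Z) = tensor_eval (\<lambda>a b. L (B a b)) Z"
  by (simp add: tensor_eval_def linear_sum linear_scale)

text \<open>Both vectors are expanded in the standard basis. This turns the cross term of Chen's
  relation into an ordinary value of \<open>B\<close>.\<close>

lemma tensor_eval_tensor:
  fixes B :: "real^'k::finite \<Rightarrow> real^'k \<Rightarrow> 'b::real_vector"
  assumes "bilinear B"
  shows "tensor_eval B (tensor a b) = B a b"
proof -
  have "x = (\<Sum>i\<in>UNIV. (x $ i) *\<^sub>R axis i 1)" for x :: "real^'k"
    using basis_expansion[of x] by (simp add: scalar_mult_eq_scaleR)
  then have "B a b = B (\<Sum>i\<in>UNIV. (a $ i) *\<^sub>R axis i 1) (\<Sum>j\<in>UNIV. (b $ j) *\<^sub>R axis j 1)"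
    by metis
  also have "\<dots> = (\<Sum>i\<in>UNIV. \<Sum>j\<in>UNIV. (a $ i * b $ j) *\<^sub>R B (axis i 1) (axis j 1))"
    using assms by (simp add: bilinear_sum sum.cartesian_product bilinear_lmul bilinear_rmul)
  finally show ?thesis by (simp add: tensor_eval_def tensor_def)
qed

text \<open>Each of the \<open>CARD('k)^2\<close> coordinates of \<open>Z\<close> is at most
  \<open>norm Z\<close>, and the basis vectors have norm 1; the constant is crude but depends on
  \<open>k\<close> alone.\<close>

lemma norm_tensor_eval_le:
  fixes B :: "real^'k::finite \<Rightarrow> real^'k \<Rightarrow> 'b::real_normed_vector"
  assumes "\<And>a b. norm (B a b) \<le> K * norm a * norm b"
  shows "norm (tensor_eval B Z) \<le> real (CARD('k))^2 * (K * norm Z)"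
proof -
  have "norm ((Z $ i $ j) *\<^sub>R B (axis i 1) (axis j 1)) \<le> K * norm Z" for i j
  proof -
    have "\<bar>Z $ i $ j\<bar> \<le> norm Z"
      using Finite_Cartesian_Product.norm_nth_le[where x = "Z $ i" and i = j] Finite_Cartesian_Product.norm_nth_le[where x = Z and i = i] by simp
    moreover have "norm (B (axis i 1) (axis j 1)) \<le> K"
      using assms[of "axis i 1" "axis j 1"] by simp
    ultimately have "\<bar>Z $ i $ j\<bar> * norm (B (axis i 1) (axis j 1)) \<le> norm Z * K"
      by (intro mult_mono) auto
    then show ?thesis by (simp add: mult.commute)
  qed
  then have "norm (tensor_eval B Z) \<le> (\<Sum>i\<in>(UNIV::'k set). \<Sum>j\<in>(UNIV::'k set). K * norm Z)"
    unfolding tensor_eval_def by (intro sum_norm_le)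
  then show ?thesis by (simp add: power2_eq_square mult.assoc)
qed

section \<open>Orders of magnitude along the rough path\<close>

text \<open>The quantity of homogeneous degree one: order \<open>i/p\<close> in
  \<open>\<omega>\<close> becomes the power \<open>i\<close> of \<open>rho\<close>, so that
  estimates turn into polynomial arithmetic.\<close>

definition rho :: "('k::finite) rough_path \<Rightarrow> real \<Rightarrow> real \<Rightarrow> real" where
  "rho X s t = rp\<omega> X s t powr (1 / rpp X)"

lemma rho_nonneg [simp]: "0 \<le> rho X s t"
  by (simp add: rho_def)

lemma powr_eq_rho:
  "rp\<omega> X s t powr (1 / rpp X) = rho X s t"
  "rp\<omega> X s t powr (2 / rpp X) = (rho X s t)\<^sup>2"
  "rp\<omega> X s t powr (3 / rpp X) = rho X s t ^ 3"
  by (cases "rp\<omega> X s t = 0"; simp add: rho_def powr_power)+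

lemma approxD:
  assumes "approx X i ok N F E"
  shows "\<exists>C\<ge>0. \<exists>\<delta>>0. \<forall>s t. 0 \<le> s \<longrightarrow> s \<le> t \<longrightarrow> t \<le> rpT X \<longrightarrow> t - s \<le> \<delta> \<longrightarrow>
    ok s t \<and> N s (F s t - E s t) \<le> C * rp\<omega> X s t powr (i / rpp X)"
proof -
  obtain C \<delta> where C: "0 < \<delta>" "\<forall>s t. 0 \<le> s \<and> s \<le> t \<and> t \<le> rpT X \<and> t - s \<le> \<delta> \<longrightarrow>
        ok s t \<and> N s (F s t - E s t) \<le> C * rp\<omega> X s t powr (i / rpp X)"
    using assms unfolding approx_def by blast
  have "C * rp\<omega> X s t powr (i / rpp X) \<le> \<bar>C\<bar> * rp\<omega> X s t powr (i / rpp X)" for s t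
    by (intro mult_right_mono) auto
  then have "\<forall>s t. 0 \<le> s \<longrightarrow> s \<le> t \<longrightarrow> t \<le> rpT X \<longrightarrow> t - s \<le> \<delta> \<longrightarrow>
    ok s t \<and> N s (F s t - E s t) \<le> \<bar>C\<bar> * rp\<omega> X s t powr (i / rpp X)"
    using C(2) by (meson order_trans)
  then show ?thesis using C(1) abs_ge_zero[of C] by blast
qed

lemma approxI:
  assumes "0 < \<delta>" "\<And>s t. \<lbrakk>0 \<le> s; s \<le> t; t \<le> rpT X; t - s \<le> \<delta>\<rbrakk>
      \<Longrightarrow> ok s t \<and> N s (F s t - E s t) \<le> C * rp\<omega> X s t powr (i / rpp X)"
  shows "approx X i ok N F E"
  using assms unfolding approx_def by blast

context
  fixes X :: "('k::finite) rough_path"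
  assumes X: "weak_geometric_rough_path X"
begin

lemma rough_path_basics:
  "0 < rpT X" "0 < rpp X" "1 < 3 / rpp X" "control (rpT X) (rp\<omega> X)"
  using X by (auto simp: weak_geometric_rough_path_def Let_def)

lemma chen:
  "\<lbrakk>0 \<le> s; s \<le> u; u \<le> t; t \<le> rpT X\<rbrakk> \<Longrightarrow>
    rpX X s t = rpX X s u + rpX X u t + tensor (rpx X u - rpx X s) (rpx X t - rpx X u)"
  using X by (auto simp: weak_geometric_rough_path_def Let_def)

lemma norm_increment_le:
  assumes "0 \<le> s" "s \<le> t" "t \<le> rpT X"
  shows "norm (rpx X t - rpx X s) \<le> rho X s t" "norm (rpX X s t) \<le> (rho X s t)\<^sup>2"
  using X assms
  by (auto simp: weak_geometric_rough_path_def Let_def simplex2_def powr_eq_rho)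

lemma rho_mono:
  assumes "0 \<le> s'" "s' \<le> s" "s \<le> t" "t \<le> t'" "t' \<le> rpT X"
  shows "rho X s t \<le> rho X s' t'"
  unfolding rho_def using assms rough_path_basics by (intro control_powr_mono) auto

lemma rho_refl: "\<lbrakk>0 \<le> s; s \<le> rpT X\<rbrakk> \<Longrightarrow> rho X s s = 0"
  using control_refl[OF rough_path_basics(4)] by (simp add: rho_def)

lemma rough_path_diag: "\<lbrakk>0 \<le> s; s \<le> rpT X\<rbrakk> \<Longrightarrow> rpX X s s = 0"
  using norm_increment_le(2)[of s s] rho_refl[of s] by simp

lemma continuous_on_if_rho:
  fixes h :: "real \<Rightarrow> 'a::real_normed_vector"
  assumes "\<And>s t. \<lbrakk>0 \<le> s; s \<le> t; t \<le> rpT X\<rbrakk> \<Longrightarrow> norm (h t - h s) \<le> C * rho X s t"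
  shows "continuous_on {0..rpT X} h"
  unfolding continuous_on_iff
proof (intro ballI allI impI)
  fix s e :: real assume s: "s \<in> {0..rpT X}" and "e > 0"
  \<comment> \<open>Chosen so that \<open>\<omega> < r\<close> means
    \<open>rho < e / (\<bar>C\<bar> + 1)\<close>.\<close>
  define r where "r = (e / (\<bar>C\<bar> + 1)) powr rpp X"
  have "r > 0" using \<open>e > 0\<close> by (simp add: r_def)
  then obtain \<delta> where \<delta>: "0 < \<delta>" "\<And>s t. \<lbrakk>0 \<le> s; s \<le> t; t \<le> rpT X; t - s < \<delta>\<rbrakk> \<Longrightarrow> rp\<omega> X s t < r"
    using control_small[OF rough_path_basics(4)] by blast
  have *: "norm (h t - h s) < e" if "0 \<le> s" "s \<le> t" "t \<le> rpT X" "t - s < \<delta>" for s t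
  proof -
    have "rho X s t < r powr (1 / rpp X)"
      unfolding rho_def using \<delta>(2)[OF that] control_nonneg[OF rough_path_basics(4) that(1-3)]
        rough_path_basics(2) by (intro powr_less_mono2) auto
    also have "\<dots> = e / (\<bar>C\<bar> + 1)"
      using \<open>e > 0\<close> rough_path_basics(2) by (simp add: r_def powr_powr)
    finally have "(\<bar>C\<bar> + 1) * rho X s t < e" by (simp add: field_simps)
    moreover have "C * rho X s t \<le> (\<bar>C\<bar> + 1) * rho X s t" by (intro mult_right_mono) auto
    ultimately show ?thesis using assms[OF that(1-3)] by linarith
  qed
  show "\<exists>d>0. \<forall>t\<in>{0..rpT X}. dist t s < d \<longrightarrow> dist (h t) (h s) < e"
  proof (intro exI[of _ \<delta>] conjI \<delta>(1) ballI impI)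
    fix t assume "t \<in> {0..rpT X}" "dist t s < \<delta>"
    then show "dist (h t) (h s) < e"
      using *[of s t] *[of t s] s
      by (cases "s \<le> t") (auto simp: dist_norm norm_minus_commute)
  qed
qed

text \<open>One constant for all five estimates keeps later products short. The sup bounds come from
  compactness of \<open>[0,T]\<close>, and the increment bound for \<open>z\<close> from its
  expansion together with the bound on \<open>z'\<close>.\<close>

lemma CRP_bounds:
  fixes z :: "real \<Rightarrow> 'v::real_normed_vector"
  assumes "(z, z') \<in> CRP X"
  obtains C where "0 \<le> C"
    "\<And>s. \<lbrakk>0 \<le> s; s \<le> rpT X\<rbrakk> \<Longrightarrow> norm (z s) \<le> C"
    "\<And>s. \<lbrakk>0 \<le> s; s \<le> rpT X\<rbrakk> \<Longrightarrow> norm (z' s) \<le> C"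
    "\<And>s t. \<lbrakk>0 \<le> s; s \<le> t; t \<le> rpT X\<rbrakk>
      \<Longrightarrow> norm (z t - z s - z' s (rpx X t - rpx X s)) \<le> C * (rho X s t)\<^sup>2"
    "\<And>s t. \<lbrakk>0 \<le> s; s \<le> t; t \<le> rpT X\<rbrakk> \<Longrightarrow> norm (z t - z s) \<le> C * rho X s t"
    "\<And>s t. \<lbrakk>0 \<le> s; s \<le> t; t \<le> rpT X\<rbrakk> \<Longrightarrow> norm (z' t - z' s) \<le> C * rho X s t"
proof -
  let ?I = "{0..rpT X}"
  have cont: "continuous_on ?I z" "continuous_on ?I z'" using assms by (auto simp: CRP_def)
  obtain C1 where C1: "\<And>s t. \<lbrakk>0 \<le> s; s \<le> t; t \<le> rpT X\<rbrakk>
      \<Longrightarrow> norm (z t - z s - z' s (rpx X t - rpx X s)) \<le> C1 * (rho X s t)\<^sup>2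
        \<and> norm (z' t - z' s) \<le> C1 * rho X s t"
    using assms by (auto simp: CRP_def powr_eq_rho)
  have "bounded (z ` ?I)" "bounded (z' ` ?I)"
    by (intro compact_imp_bounded compact_continuous_image cont compact_Icc)+
  then obtain C2 C3 where C2: "\<And>s. s \<in> ?I \<Longrightarrow> norm (z s) \<le> C2"
    and C3: "\<And>s. s \<in> ?I \<Longrightarrow> norm (z' s) \<le> C3"
    unfolding bounded_iff by blast
  define R where "R = rho X 0 (rpT X)"
  \<comment> \<open>The factor \<open>1 + R\<close> pays for
    \<open>rho\<^sup>2 \<le> R * rho\<close>, where \<open>R\<close> is \<open>rho\<close> over the
    whole interval.\<close>
  define C where "C = \<bar>C1\<bar> * (1 + R) + \<bar>C2\<bar> + \<bar>C3\<bar>"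
  have R: "R \<ge> 0" by (simp add: R_def)
  have C: "\<bar>C1\<bar> \<le> C" "C2 \<le> C" "C3 \<le> C" "\<bar>C1\<bar> * R + \<bar>C3\<bar> \<le> C" "0 \<le> C"
    using R mult_nonneg_nonneg[OF abs_ge_zero[of C1] R] unfolding C_def distrib_left by linarith+
  have up: "C1 * a \<le> C * a" if "0 \<le> a" for a :: real
    using that C(1) by (intro mult_right_mono) auto
  show thesis
  proof (rule that[of C])
    fix s t assume st: "0 \<le> s" "s \<le> t" "t \<le> rpT X"
    let ?r = "rho X s t"
    show "norm (z t - z s - z' s (rpx X t - rpx X s)) \<le> C * ?r\<^sup>2" "norm (z' t - z' s) \<le> C * ?r"
      using C1[OF st] up[of "?r\<^sup>2"] up[of "?r"] by auto
    have "norm (z t - z s) \<le> norm (z t - z s - z' s (rpx X t - rpx X s)) + norm (z' s (rpx X t - rpx X s))"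
      using norm_triangle_ineq[of "z t - z s - z' s (rpx X t - rpx X s)" "z' s (rpx X t - rpx X s)"] by simp
    also have "\<dots> \<le> \<bar>C1\<bar> * R * ?r + \<bar>C3\<bar> * ?r"
    proof (intro add_mono)
      have "norm (z t - z s - z' s (rpx X t - rpx X s)) \<le> C1 * ?r\<^sup>2" using C1[OF st] by simp
      also have "\<dots> \<le> \<bar>C1\<bar> * (R * ?r)"
        unfolding power2_eq_square R_def using st by (intro mult_mono mult_right_mono rho_mono) auto
      finally show "norm (z t - z s - z' s (rpx X t - rpx X s)) \<le> \<bar>C1\<bar> * R * ?r" by simp
      show "norm (z' s (rpx X t - rpx X s)) \<le> \<bar>C3\<bar> * ?r"
        using norm_increment_le(1)[OF st] C3[of s] st
        by (intro order_trans[OF norm_blinfun] mult_mono) auto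
    qed
    also have "\<dots> = (\<bar>C1\<bar> * R + \<bar>C3\<bar>) * ?r" by (simp add: algebra_simps)
    also have "\<dots> \<le> C * ?r" by (intro mult_right_mono C) auto
    finally show "norm (z t - z s) \<le> C * ?r" .
  qed (use C C2 C3 in \<open>auto intro: order_trans\<close>)
qed

lemma CRP_bounded:
  assumes "(z, z') \<in> CRP X"
  shows "\<exists>C\<ge>0. \<forall>s. 0 \<le> s \<longrightarrow> s \<le> rpT X \<longrightarrow> norm (z s) \<le> C"
proof -
  have "bounded (z ` {0..rpT X})"
    using assms by (intro compact_imp_bounded compact_continuous_image) (auto simp: CRP_def)
  then obtain C where "C > 0" "\<forall>v\<in>z ` {0..rpT X}. norm v \<le> C" unfolding bounded_pos by blast
  then show ?thesis by (intro exI[of _ C]) auto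
qed

text \<open>Sewing is applied to the local expansion \<open>\<Xi>\<close> with exponent
  \<open>3/p\<close>. Chen's relation cancels the terms of order two in the defect, which leaves
  products of total order three.\<close>

lemma flat_integral_exists:
  fixes f :: "real \<Rightarrow> 'v::banach \<Rightarrow>\<^sub>L 'u::banach"
  assumes f: "(f, f') \<in> CRP X" and z: "(z, z') \<in> CRP X"
  shows "\<exists>q. is_flat_integral X (f, f') (z, z') q"
proof -
  let ?T = "rpT X" and ?n = "real (CARD('k))^2"
  obtain C where C: "0 \<le> C"
    "\<And>s. \<lbrakk>0 \<le> s; s \<le> rpT X\<rbrakk> \<Longrightarrow> norm (z s) \<le> C"
    "\<And>s. \<lbrakk>0 \<le> s; s \<le> rpT X\<rbrakk> \<Longrightarrow> norm (z' s) \<le> C"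
    "\<And>s t. \<lbrakk>0 \<le> s; s \<le> t; t \<le> rpT X\<rbrakk>
      \<Longrightarrow> norm (z t - z s - z' s (rpx X t - rpx X s)) \<le> C * (rho X s t)\<^sup>2"
    "\<And>s t. \<lbrakk>0 \<le> s; s \<le> t; t \<le> rpT X\<rbrakk> \<Longrightarrow> norm (z t - z s) \<le> C * rho X s t"
    "\<And>s t. \<lbrakk>0 \<le> s; s \<le> t; t \<le> rpT X\<rbrakk> \<Longrightarrow> norm (z' t - z' s) \<le> C * rho X s t"
    using CRP_bounds[OF z] by blast
  obtain D where D: "0 \<le> D"
    "\<And>s. \<lbrakk>0 \<le> s; s \<le> rpT X\<rbrakk> \<Longrightarrow> norm (f s) \<le> D"
    "\<And>s. \<lbrakk>0 \<le> s; s \<le> rpT X\<rbrakk> \<Longrightarrow> norm (f' s) \<le> D"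
    "\<And>s t. \<lbrakk>0 \<le> s; s \<le> t; t \<le> rpT X\<rbrakk>
      \<Longrightarrow> norm (f t - f s - f' s (rpx X t - rpx X s)) \<le> D * (rho X s t)\<^sup>2"
    "\<And>s t. \<lbrakk>0 \<le> s; s \<le> t; t \<le> rpT X\<rbrakk> \<Longrightarrow> norm (f t - f s) \<le> D * rho X s t"
    "\<And>s t. \<lbrakk>0 \<le> s; s \<le> t; t \<le> rpT X\<rbrakk> \<Longrightarrow> norm (f' t - f' s) \<le> D * rho X s t"
    using CRP_bounds[OF f] by blast
  have app: "norm (L v) \<le> a * b" if "norm L \<le> a" "norm v \<le> b"
    for L :: "'x::real_normed_vector \<Rightarrow>\<^sub>L 'y::real_normed_vector" and v a b
    using that by (intro order_trans[OF norm_blinfun] mult_mono) (auto intro: order_trans[OF norm_ge_zero])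
  define te where "te s Z = tensor_eval (\<lambda>a b. f' s a (z' s b)) Z" for s Z
  define \<Xi> where "\<Xi> s t = f s (z t - z s) + te s (rpX X s t)" for s t
  have te_bound: "norm (te s Z) \<le> ?n * (D * C * norm Z)" if s: "0 \<le> s" "s \<le> ?T" for s Z
    unfolding te_def
  proof (rule norm_tensor_eval_le)
    fix a b
    have "norm (f' s a (z' s b)) \<le> (D * norm a) * (C * norm b)"
      by (intro app D C s order_refl)
    then show "norm (f' s a (z' s b)) \<le> D * C * norm a * norm b" by (simp add: mult_ac)
  qed
  define M where "M = D * C + D * (C + C) + ?n * (2 * D * C)"
  have defect: "norm (\<Xi> s t - \<Xi> s u - \<Xi> u t) \<le> M * rp\<omega> X s t powr (3 / rpp X)"
    if o: "0 \<le> s" "s \<le> u" "u \<le> t" "t \<le> ?T" for s u t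
  proof -
    let ?r = "rho X s t"
    have o1: "0 \<le> s" "s \<le> u" "u \<le> ?T" and o2: "0 \<le> u" "u \<le> t" "t \<le> ?T" and s: "s \<le> ?T" using o by auto
    have r: "rho X s u \<le> ?r" "rho X u t \<le> ?r" using o by (auto intro!: rho_mono)
    define xsu xut where "xsu = rpx X u - rpx X s" and "xut = rpx X t - rpx X u"
    have x: "norm xsu \<le> ?r" "norm xut \<le> ?r"
      using norm_increment_le(1)[OF o1] norm_increment_le(1)[OF o2] r by (auto simp: xsu_def xut_def)
    have XX: "norm (rpX X u t) \<le> ?r\<^sup>2"
      using r(2) by (intro order_trans[OF norm_increment_le(2)[OF o2]] power_mono) auto
    have bil: "bilinear (\<lambda>a b. f' s a (z' s b))"
      by (auto simp: bilinear_def blinfun.add_left blinfun.add_right blinfun.scaleR_left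
          blinfun.scaleR_right intro!: linearI)
    have "te s (rpX X s t) = te s (rpX X s u) + te s (rpX X u t) + f' s xsu (z' s xut)"
      using chen[OF o] unfolding te_def xsu_def xut_def by (simp add: tensor_eval_add tensor_eval_tensor[OF bil])
    \<comment> \<open>Written so that each summand has order three: a remainder of \<open>f\<close>
      times an increment of \<open>z\<close>, an increment of \<open>x\<close> times a remainder of
      \<open>z\<close>, and an increment of the product of the derivatives times the second level.
      Chen's cross term carries \<open>z' s\<close> while the remainder of \<open>z\<close> is based
      at \<open>u\<close>; the difference \<open>z' u - z' s\<close> corrects this.\<close>
    then have eq: "\<Xi> s t - \<Xi> s u - \<Xi> u t =
        - ((f u - f s - f' s xsu) (z t - z u))
        - f' s xsu ((z t - z u - z' u xut) + (z' u - z' s) xut)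
        + tensor_eval (\<lambda>a b. f' s a (z' s b) - f' u a (z' u b)) (rpX X u t)"
      by (simp add: \<Xi>_def te_def tensor_eval_fun_diff blinfun.diff_left blinfun.diff_right blinfun.add_right)
    have le: "C * rho X u t \<le> C * ?r" "C * rho X s u \<le> C * ?r" "D * rho X s u \<le> D * ?r"
      "D * (rho X s u)\<^sup>2 \<le> D * ?r\<^sup>2" "C * (rho X u t)\<^sup>2 \<le> C * ?r\<^sup>2"
      using r C(1) D(1) by (auto intro!: mult_left_mono power_mono)
    have 1: "norm ((f u - f s - f' s xsu) (z t - z u)) \<le> (D * ?r\<^sup>2) * (C * ?r)"
      unfolding xsu_def
      by (intro app order_trans[OF D(4)[OF o1] le(4)] order_trans[OF C(5)[OF o2] le(1)])
    have 2: "norm (f' s xsu ((z t - z u - z' u xut) + (z' u - z' s) xut))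
        \<le> (D * ?r) * (C * ?r\<^sup>2 + (C * ?r) * ?r)"
      by (intro app D(3) o1 s x order_trans[OF norm_triangle_ineq] add_mono
          order_trans[OF C(4)[OF o2, folded xut_def] le(5)] order_trans[OF C(6)[OF o1] le(2)])
    have 3: "norm (tensor_eval (\<lambda>a b. f' s a (z' s b) - f' u a (z' u b)) (rpX X u t))
      \<le> ?n * ((2 * D * C * ?r) * norm (rpX X u t))"
    proof (rule norm_tensor_eval_le)
      fix a b
      have "f' s a (z' s b) - f' u a (z' u b) = f' s a ((z' s - z' u) b) + (f' s - f' u) a (z' u b)"
        by (simp add: blinfun.diff_left blinfun.diff_right)
      also have "norm \<dots> \<le> (D * norm a) * (C * ?r * norm b) + (D * ?r * norm a) * (C * norm b)"
      proof (intro norm_triangle_mono app order_refl)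
        show "norm (f' s) \<le> D" "norm (z' u) \<le> C" using o1 s D C by auto
        show "norm (z' s - z' u) \<le> C * ?r" "norm (f' s - f' u) \<le> D * ?r"
          using C(6)[OF o1] D(6)[OF o1] le by (auto simp: norm_minus_commute)
      qed
      also have "\<dots> = 2 * D * C * ?r * norm a * norm b" by (simp add: algebra_simps)
      finally show "norm (f' s a (z' s b) - f' u a (z' u b)) \<le> 2 * D * C * ?r * norm a * norm b" .
    qed
    also have "\<dots> \<le> ?n * ((2 * D * C * ?r) * ?r\<^sup>2)"
      using C(1) D(1) by (intro mult_left_mono XX) auto
    finally have 3: "norm (tensor_eval (\<lambda>a b. f' s a (z' s b) - f' u a (z' u b)) (rpX X u t))
      \<le> ?n * ((2 * D * C * ?r) * ?r\<^sup>2)" .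
    have "norm (\<Xi> s t - \<Xi> s u - \<Xi> u t) \<le> (D * ?r\<^sup>2) * (C * ?r)
        + (D * ?r) * (C * ?r\<^sup>2 + (C * ?r) * ?r) + ?n * ((2 * D * C * ?r) * ?r\<^sup>2)"
      unfolding eq
      by (intro norm_triangle_mono order_trans[OF norm_triangle_ineq4] add_mono 2 3) (simp add: 1)
    also have "\<dots> = M * ?r ^ 3" by (simp add: M_def power2_eq_square power3_eq_cube algebra_simps)
    finally show ?thesis by (simp add: powr_eq_rho)
  qed
  have "0 \<le> M" using C(1) D(1) by (simp add: M_def)
  moreover have "\<Xi> s s = 0" if "0 \<le> s" "s \<le> ?T" for s
    using rough_path_diag[OF that] by (simp add: \<Xi>_def te_def tensor_eval_def)
  ultimately obtain J K where J: "J 0 = 0" "0 \<le> K"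
    "\<And>s t. \<lbrakk>0 \<le> s; s \<le> t; t \<le> ?T\<rbrakk> \<Longrightarrow> norm (J t - J s - \<Xi> s t) \<le> K * rp\<omega> X s t powr (3 / rpp X)"
    using sewing[OF rough_path_basics(4,3) _ rough_path_basics(1) _ defect] by blast
  \<comment> \<open>Paths in \<open>CRP\<close> are extensional, so \<open>J\<close> is cut off
    outside \<open>[0,T]\<close>.\<close>
  define q where "q = restrict J {0..?T}"
  define q' where "q' = restrict (\<lambda>s. f s o\<^sub>L z' s) {0..?T}"
  define R where "R = rho X 0 ?T"
  \<comment> \<open>One summand for each part of the remainder of \<open>q\<close>: the sewing
    error, cubic in \<open>rho\<close> and reduced by \<open>rho \<le> R\<close>; \<open>f s\<close>
    applied to the remainder of \<open>z\<close>; and the second-level term.\<close>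
  define E where "E = K * R + D * C + ?n * (D * C)"
  have E: "norm (q t - q s - q' s (rpx X t - rpx X s)) \<le> E * (rho X s t)\<^sup>2"
    "norm (q' t - q' s) \<le> 2 * D * C * rho X s t" if st: "0 \<le> s" "s \<le> t" "t \<le> ?T" for s t
  proof -
    let ?r = "rho X s t"
    have r: "?r \<le> R" using st by (auto simp: R_def intro!: rho_mono)
    have s: "0 \<le> s" "s \<le> ?T" and t: "0 \<le> t" "t \<le> ?T" using st by auto
    have "q t - q s - q' s (rpx X t - rpx X s) = (J t - J s - \<Xi> s t)
        + f s (z t - z s - z' s (rpx X t - rpx X s)) + te s (rpX X s t)"
      using st by (simp add: q_def q'_def \<Xi>_def blinfun.diff_right)
    also have "norm \<dots> \<le> K * R * ?r\<^sup>2 + D * (C * ?r\<^sup>2) + ?n * (D * C * ?r\<^sup>2)"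
    proof (intro norm_triangle_mono app D(2) C(4) st s)
      have "norm (J t - J s - \<Xi> s t) \<le> K * (?r * ?r\<^sup>2)"
        using J(3)[OF st] by (simp add: powr_eq_rho power3_eq_cube power2_eq_square)
      also have "\<dots> \<le> K * (R * ?r\<^sup>2)" by (intro mult_left_mono mult_right_mono r J) auto
      finally show "norm (J t - J s - \<Xi> s t) \<le> K * R * ?r\<^sup>2" by simp
      show "norm (te s (rpX X s t)) \<le> ?n * (D * C * ?r\<^sup>2)"
        using C(1) D(1) norm_increment_le(2)[OF st]
        by (intro order_trans[OF te_bound[OF s]] mult_left_mono) auto
    qed
    also have "\<dots> = E * ?r\<^sup>2" by (simp add: E_def algebra_simps)
    finally show "norm (q t - q s - q' s (rpx X t - rpx X s)) \<le> E * ?r\<^sup>2" .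
    have "q' t - q' s = (f t o\<^sub>L (z' t - z' s)) + ((f t - f s) o\<^sub>L z' s)"
      using st by (intro blinfun_eqI) (simp add: q'_def blinfun.diff_left blinfun.diff_right blinfun.add_left)
    also have "norm \<dots> \<le> D * (C * ?r) + (D * ?r) * C"
      using C(1) D(1)
      by (intro norm_triangle_mono order_trans[OF norm_blinfun_compose] mult_mono D C st s t) auto
    finally show "norm (q' t - q' s) \<le> 2 * D * C * ?r" by (simp add: algebra_simps)
  qed
  have "(q, q') \<in> CRP X"
  proof -
    have "E \<ge> 0" using J(2) C(1) D(1) by (simp add: E_def R_def)
    then have "norm (q t - q s - q' s (rpx X t - rpx X s)) \<le> (E + 2 * D * C) * rp\<omega> X s t powr (2 / rpp X)
       \<and> norm (q' t - q' s) \<le> (E + 2 * D * C) * rp\<omega> X s t powr (1 / rpp X)"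
      if "0 \<le> s" "s \<le> t" "t \<le> ?T" for s t
      using E[OF that] C(1) D(1) unfolding powr_eq_rho distrib_right
      by (meson add_increasing add_increasing2 mult_nonneg_nonneg rho_nonneg zero_le_numeral zero_le_power2)
    moreover have "continuous_on {0..?T} q'" by (rule continuous_on_if_rho[OF E(2)])
    moreover have "continuous_on {0..?T} q"
    proof (rule continuous_on_if_rho)
      fix s t assume st: "0 \<le> s" "s \<le> t" "t \<le> ?T"
      let ?r = "rho X s t"
      have "norm (q' s) \<le> D * C"
        using st C(1) D(1) by (auto simp: q'_def intro!: order_trans[OF norm_blinfun_compose] mult_mono D C)
      then have "norm (q' s (rpx X t - rpx X s)) \<le> (D * C) * ?r"
        by (intro app norm_increment_le st)
      moreover have "E * ?r\<^sup>2 \<le> E * R * ?r"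
        using \<open>E \<ge> 0\<close> st unfolding R_def power2_eq_square mult.assoc
        by (intro mult_left_mono mult_right_mono rho_mono) auto
      ultimately show "norm (q t - q s) \<le> (E * R + D * C) * ?r"
        using E(1)[OF st] norm_triangle_ineq[of "q t - q s - q' s (rpx X t - rpx X s)" "q' s (rpx X t - rpx X s)"]
        unfolding distrib_right by simp
    qed
    ultimately show ?thesis by (auto simp: CRP_def q_def q'_def)
  qed
  \<comment> \<open>The sewing estimate holds on all of \<open>[0,T]\<close>, so any positive
    \<open>\<delta>\<close> serves; 1 is a placeholder.\<close>
  moreover have "approx X 3 (\<lambda>s t. True) (\<lambda>s. norm) (\<lambda>s t. q t - q s)
       (\<lambda>s t. f s (z t - z s) + tensor_eval (\<lambda>a b. f' s a (z' s b)) (rpX X s t))"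
    unfolding approx_def
    using J(3) by (intro exI[of _ K] exI[of _ 1]) (auto simp: q_def \<Xi>_def te_def)
  ultimately have "is_flat_integral X (f, f') (z, z') (q, q')"
    using J(1) rough_path_basics(1) by (auto simp: q_def q'_def)
  then show ?thesis by blast
qed

text \<open>Both paths share the same local expansion, so their difference starts at 0 and has
  increments of order \<open>3/p > 1\<close>. The derivative components are prescribed on
  \<open>[0,T]\<close>.\<close>

lemma flat_integral_unique:
  fixes f :: "real \<Rightarrow> 'v::banach \<Rightarrow>\<^sub>L 'u::banach"
  assumes q: "is_flat_integral X (f, f') (z, z') (q, q')" and r: "is_flat_integral X (f, f') (z, z') (r, r')"
  shows "q = r \<and> q' = r'"
proof -
  let ?T = "rpT X"
  have ext: "q \<in> extensional {0..?T}" "r \<in> extensional {0..?T}"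
    "q' \<in> extensional {0..?T}" "r' \<in> extensional {0..?T}" using q r by (auto simp: CRP_def)
  define E where "E s t = f s (z t - z s) + tensor_eval (\<lambda>a b. f' s a (z' s b)) (rpX X s t)" for s t
  have ap: "approx X 3 (\<lambda>s t. True) (\<lambda>s. norm) (\<lambda>s t. q t - q s) E"
    "approx X 3 (\<lambda>s t. True) (\<lambda>s. norm) (\<lambda>s t. r t - r s) E"
    using q r by (simp_all add: E_def[abs_def])
  obtain C1 \<delta>1 where "0 < \<delta>1"
    and 1: "\<And>s t. \<lbrakk>0 \<le> s; s \<le> t; t \<le> ?T; t - s \<le> \<delta>1\<rbrakk>
      \<Longrightarrow> norm (q t - q s - E s t) \<le> C1 * rp\<omega> X s t powr (3 / rpp X)"
    using approxD[OF ap(1)] by blast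
  obtain C2 \<delta>2 where "0 < \<delta>2"
    and 2: "\<And>s t. \<lbrakk>0 \<le> s; s \<le> t; t \<le> ?T; t - s \<le> \<delta>2\<rbrakk>
      \<Longrightarrow> norm (r t - r s - E s t) \<le> C2 * rp\<omega> X s t powr (3 / rpp X)"
    using approxD[OF ap(2)] by blast
  note d = \<open>0 < \<delta>1\<close> \<open>0 < \<delta>2\<close>
  have "q t - r t = 0" if t: "0 \<le> t" "t \<le> ?T" for t
  proof (rule small_increments_imp_zero[OF rough_path_basics(4,3) _ _ _ t, where d = "\<lambda>t. q t - r t"
        and \<delta> = "min \<delta>1 \<delta>2" and C = "C1 + C2"])
    fix s t assume st: "0 \<le> s" "s \<le> t" "t \<le> ?T" "t - s \<le> min \<delta>1 \<delta>2"
    show "norm (q t - r t - (q s - r s)) \<le> (C1 + C2) * rp\<omega> X s t powr (3 / rpp X)"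
      using norm_triangle_ineq4[of "q t - q s - E s t" "r t - r s - E s t"] 1[of s t] 2[of s t] st
      by (simp add: algebra_simps)
  qed (use q r d in auto)
  then have "q = r" by (intro extensionalityI[OF ext(1,2)]) auto
  moreover have "q' = r'" using q r by (intro extensionalityI[OF ext(3,4)]) auto
  ultimately show ?thesis by blast
qed

end

section \<open>Comparison of the two local expansions\<close>

text \<open>Two conditions of definedness occur because the flat expansion makes sense everywhere
  and the gauge expansion only on the gauge domain; the condition of the last comparison
  survives.\<close>

lemma approx_trans:
  fixes F :: "real \<Rightarrow> real \<Rightarrow> 'a::real_normed_vector"
  assumes "approx X i ok (\<lambda>s. norm) F E" "approx X i ok' (\<lambda>s. norm) E D"
  shows "approx X i ok' (\<lambda>s. norm) F D"
proof -
  obtain C1 \<delta>1 where "0 < \<delta>1"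
    and 1: "\<And>s t. \<lbrakk>0 \<le> s; s \<le> t; t \<le> rpT X; t - s \<le> \<delta>1\<rbrakk>
      \<Longrightarrow> norm (F s t - E s t) \<le> C1 * rp\<omega> X s t powr (i / rpp X)"
    using approxD[OF assms(1)] by blast
  obtain C2 \<delta>2 where "0 < \<delta>2"
    and ok: "\<And>s t. \<lbrakk>0 \<le> s; s \<le> t; t \<le> rpT X; t - s \<le> \<delta>2\<rbrakk> \<Longrightarrow> ok' s t"
    and 2: "\<And>s t. \<lbrakk>0 \<le> s; s \<le> t; t \<le> rpT X; t - s \<le> \<delta>2\<rbrakk>
      \<Longrightarrow> norm (E s t - D s t) \<le> C2 * rp\<omega> X s t powr (i / rpp X)"
    using approxD[OF assms(2)] by blast
  have "ok' s t \<and> norm (F s t - D s t) \<le> (C1 + C2) * rp\<omega> X s t powr (i / rpp X)"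
    if "0 \<le> s" "s \<le> t" "t \<le> rpT X" "t - s \<le> min \<delta>1 \<delta>2" for s t
    using norm_triangle_ineq[of "F s t - E s t" "E s t - D s t"] 1[of s t] 2[of s t] ok[of s t] that
    by (auto simp: distrib_right)
  then show ?thesis using \<open>0 < \<delta>1\<close> \<open>0 < \<delta>2\<close> by (intro approxI[of "min \<delta>1 \<delta>2"]) auto
qed

lemma approx_sym:
  fixes F :: "real \<Rightarrow> real \<Rightarrow> 'a::real_normed_vector"
  shows "approx X i ok (\<lambda>s. norm) F E \<Longrightarrow> approx X i ok (\<lambda>s. norm) E F"
  by (simp add: approx_def norm_minus_commute)

lemma approx_mono:
  "\<lbrakk>approx X i ok N F E; \<And>s t. ok s t \<Longrightarrow> ok' s t\<rbrakk> \<Longrightarrow> approx X i ok' N F E"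
  unfolding approx_def by blast

lemma flat_integral_iff_gauge_integral:
  fixes f :: "real \<Rightarrow> 'v::banach \<Rightarrow>\<^sub>L 'u::banach"
  assumes X: "weak_geometric_rough_path X" and f: "(f, f') \<in> CRP X"
    and z: "is_gauge_integral X A G (y, y') (\<alpha>, \<alpha>') (z, z')"
  shows "is_flat_integral X (f, f') (z, z') q \<longleftrightarrow>
    is_gauge_integral X A G (y, y') (mult_along X (f, f') (\<alpha>, \<alpha>')) q"
proof -
  define Ef where "Ef s t = f s (z t - z s) + tensor_eval (\<lambda>a b. f' s a (z' s b)) (rpX X s t)" for s t
  define Ez where "Ez s t = \<alpha> s (glog G (y s) (y t) +
      tensor_eval (\<lambda>a b. gauge_tensor A G (y s) (y' s a) (y' s b)) (rpX X s t)) +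
      tensor_eval (\<lambda>a b. \<alpha>' s a (y' s b)) (rpX X s t)" for s t
  define h where "h = (\<lambda>s\<in>{0..rpT X}. f s o\<^sub>L \<alpha> s)"
  define h' where "h' = (\<lambda>s\<in>{0..rpT X}. pre_comp (f' s) (\<alpha> s) + post_comp (f s) (\<alpha>' s))"
  define Eg where "Eg s t = h s (glog G (y s) (y t) +
      tensor_eval (\<lambda>a b. gauge_tensor A G (y s) (y' s a) (y' s b)) (rpX X s t)) +
      tensor_eval (\<lambda>a b. h' s a (y' s b)) (rpX X s t)" for s t
  have z': "z' s = \<alpha> s o\<^sub>L y' s" if "s \<in> {0..rpT X}" for s using z that by simp
  \<comment> \<open>As \<open>z' s\<close> is \<open>\<alpha> s\<close> after \<open>y' s\<close>,
    the summand with \<open>f' s\<close> occurs in both expansions and cancels; every remaining term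
    has \<open>f s\<close> as its left factor.\<close>
  have eq: "Ef s t - Eg s t = f s (z t - z s - Ez s t)" if s: "s \<in> {0..rpT X}" for s t
  proof -
    have "tensor_eval (\<lambda>a b. h' s a (y' s b)) (rpX X s t)
        = tensor_eval (\<lambda>a b. f' s a (z' s b)) (rpX X s t)
          + f s (tensor_eval (\<lambda>a b. \<alpha>' s a (y' s b)) (rpX X s t))"
      using s by (simp add: h'_def z' blinfun.add_left tensor_eval_fun_add tensor_eval_linear
          bounded_linear.linear[OF blinfun.bounded_linear_right])
    then show ?thesis
      using s by (simp add: Ef_def Eg_def Ez_def h_def blinfun.diff_right blinfun.add_right)
  qed
  obtain D where D: "0 \<le> D" "\<And>s. \<lbrakk>0 \<le> s; s \<le> rpT X\<rbrakk> \<Longrightarrow> norm (f s) \<le> D"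
    using CRP_bounded[OF X f] by blast
  have apz: "approx X 3 (\<lambda>s t. (y s, y t) \<in> gdom G) (\<lambda>s. norm) (\<lambda>s t. z t - z s) Ez"
    using z by (simp add: Ez_def[abs_def])
  obtain C \<delta> where \<delta>: "0 < \<delta>"
    and ok: "\<And>s t. \<lbrakk>0 \<le> s; s \<le> t; t \<le> rpT X; t - s \<le> \<delta>\<rbrakk> \<Longrightarrow> (y s, y t) \<in> gdom G"
    and C: "\<And>s t. \<lbrakk>0 \<le> s; s \<le> t; t \<le> rpT X; t - s \<le> \<delta>\<rbrakk> \<Longrightarrow>
      norm (z t - z s - Ez s t) \<le> C * rp\<omega> X s t powr (3 / rpp X)"
    using approxD[OF apz] by blast
  have ap: "approx X 3 (\<lambda>s t. (y s, y t) \<in> gdom G) (\<lambda>s. norm) Ef Eg"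
  proof (intro approxI[OF \<delta>] conjI ok)
    fix s t assume st: "0 \<le> s" "s \<le> t" "t \<le> rpT X" "t - s \<le> \<delta>"
    have "norm (Ef s t - Eg s t) = norm (f s (z t - z s - Ez s t))" using eq[of s t] st by simp
    also have "\<dots> \<le> D * (C * rp\<omega> X s t powr (3 / rpp X))"
      using C[OF st] D(2)[of s] D(1) st by (intro order_trans[OF norm_blinfun] mult_mono) auto
    finally show "norm (Ef s t - Eg s t) \<le> D * C * rp\<omega> X s t powr (3 / rpp X)" by simp
  qed
  have "is_flat_integral X (f, f') (z, z') (q1, q2) \<longleftrightarrow>
    is_gauge_integral X A G (y, y') (mult_along X (f, f') (\<alpha>, \<alpha>')) (q1, q2)" for q1 q2
  proof -
    \<comment> \<open>From flat to gauge, the pairs \<open>(y s, y t)\<close> lie in the gauge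
      domain for short steps because the expansion of \<open>z\<close> already guarantees it; the
      converse weakens this condition to \<open>True\<close>.\<close>
    have "approx X 3 (\<lambda>s t. True) (\<lambda>s. norm) (\<lambda>s t. q1 t - q1 s) Ef \<longleftrightarrow>
      approx X 3 (\<lambda>s t. (y s, y t) \<in> gdom G) (\<lambda>s. norm) (\<lambda>s t. q1 t - q1 s) Eg"
      using approx_trans[OF _ ap] approx_trans[OF _ approx_mono[OF approx_sym[OF ap], of "\<lambda>_ _. True"]]
      by blast
    moreover have "(\<forall>s\<in>{0..rpT X}. q2 s = f s o\<^sub>L z' s) \<longleftrightarrow> (\<forall>s\<in>{0..rpT X}. q2 s = h s o\<^sub>L y' s)"
      by (intro ball_cong refl) (auto simp: h_def z' intro!: arg_cong2[where f = "(=)"] blinfun_eqI)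
    ultimately show ?thesis
      unfolding mult_along.simps is_flat_integral.simps is_gauge_integral.simps Ef_def Eg_def h_def h'_def
      by blast
  qed
  then show ?thesis by (cases q) blast
qed

section \<open>Riemannian operator norms and parallelisms in charts\<close>

text \<open>What the operator norm estimates ask of a Riemannian norm. The last clause makes its
  unit ball bounded in the ambient norm, so that the sets under \<open>Sup\<close> in
  \<open>op_norm\<close> are bounded above and the real supremum has its usual meaning.\<close>

definition norm_like :: "('a::real_normed_vector \<Rightarrow> real) \<Rightarrow> bool" where
  "norm_like N \<longleftrightarrow> (\<forall>c v. N (c *\<^sub>R v) = \<bar>c\<bar> * N v) \<and> (\<forall>v. v \<noteq> 0 \<longrightarrow> 0 < N v) \<and>
    (\<exists>K\<ge>0. \<forall>v. norm v \<le> K * N v)"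

lemma norm_like_zero: "norm_like N \<Longrightarrow> N 0 = 0"
  unfolding norm_like_def by (metis abs_zero mult_zero_left scaleR_zero_left)

lemma norm_like_nonneg: "norm_like N \<Longrightarrow> 0 \<le> N v"
  by (cases "v = 0") (auto simp: norm_like_zero norm_like_def less_imp_le)

lemma op_norm_leD:
  fixes A :: "'a::real_normed_vector \<Rightarrow>\<^sub>L 'b::real_normed_vector"
  assumes N: "norm_like N" and C: "op_norm N norm A \<le> C"
  shows "norm (A v) \<le> C * N v"
proof (cases "v = 0")
  case True
  then show ?thesis using norm_like_zero[OF N] by simp
next
  case False
  then have pos: "0 < N v" using N by (simp add: norm_like_def)
  obtain K where K: "0 \<le> K" "\<And>v. norm v \<le> K * N v" using N by (auto simp: norm_like_def)
  have bdd: "bdd_above {norm (A v) | v. N v \<le> 1}"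
  proof (rule bdd_aboveI)
    fix r assume "r \<in> {norm (A v) | v. N v \<le> 1}"
    then obtain u where u: "r = norm (A u)" "N u \<le> 1" by blast
    have "norm u \<le> K" using K(2)[of u] mult_left_mono[OF u(2) K(1)] by simp
    then show "r \<le> norm A * K"
      unfolding u(1) by (intro order_trans[OF norm_blinfun] mult_left_mono) auto
  qed
  have "N ((1 / N v) *\<^sub>R v) = 1" using N pos by (simp add: norm_like_def)
  then have "norm (A ((1 / N v) *\<^sub>R v)) \<in> {norm (A v) | v. N v \<le> 1}" by auto
  then have "norm (A ((1 / N v) *\<^sub>R v)) \<le> C"
    using cSup_upper[OF _ bdd] C unfolding op_norm_def by (meson order_trans)
  then show ?thesis using pos by (simp add: blinfun.scaleR_right field_simps)
qed

text \<open>\<open>N'\<close> is arbitrary so that it may itself be an operator norm, as in the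
  nested norm on \<open>L(W, L(E, V))\<close>.\<close>

lemma op_norm_leI:
  assumes N: "norm_like N" and C: "0 \<le> C" "\<And>v. N' (A v) \<le> C * N v"
  shows "op_norm N N' A \<le> C"
  unfolding op_norm_def
proof (rule cSup_least)
  show "{N' (A v) | v. N v \<le> 1} \<noteq> {}" using norm_like_zero[OF N] by (auto intro: exI[of _ 0])
  fix r assume "r \<in> {N' (A v) | v. N v \<le> 1}"
  then obtain v where "r = N' (A v)" "N v \<le> 1" by blast
  then show "r \<le> C" using C(2)[of v] mult_left_mono[of "N v" 1 C] C(1) by simp
qed

lemma norm_like_norm: "norm_like norm"
  unfolding norm_like_def by (auto intro!: exI[of _ 1])

text \<open>The suprema are nested, so the inner operator norms must first be bounded uniformly over
  the unit ball of \<open>W\<close>; rescaling \<open>w\<close> then reduces to the single operator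
  norm.\<close>

lemma op_norm2_leD:
  fixes B :: "'w::real_normed_vector \<Rightarrow>\<^sub>L ('a::real_normed_vector \<Rightarrow>\<^sub>L 'b::real_normed_vector)"
  assumes N: "norm_like N" and C: "op_norm norm (\<lambda>A. op_norm N norm (blinfun_apply A)) B \<le> C"
  shows "norm (B w v) \<le> C * norm w * N v"
proof (cases "w = 0")
  case True
  then show ?thesis by simp
next
  case False
  obtain K where K: "0 \<le> K" "\<And>v. norm v \<le> K * N v" using N by (auto simp: norm_like_def)
  have le: "op_norm N norm (B u) \<le> norm B * norm u * K" for u
  proof (rule op_norm_leI[OF N])
    fix v
    have "norm (B u v) \<le> (norm B * norm u) * (K * N v)"
      using norm_like_nonneg[OF N, of v]
      by (intro order_trans[OF norm_blinfun] mult_mono norm_blinfun K) auto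
    then show "norm (B u v) \<le> norm B * norm u * K * N v" by simp
  qed (use K in auto)
  have bdd: "bdd_above {op_norm N norm (B u) | u. norm u \<le> 1}"
  proof (rule bdd_aboveI)
    fix r assume "r \<in> {op_norm N norm (B u) | u. norm u \<le> 1}"
    then obtain u where u: "r = op_norm N norm (B u)" "norm u \<le> 1" by blast
    have "norm B * norm u * K \<le> norm B * 1 * K"
      using u(2) K(1) by (intro mult_right_mono mult_left_mono) auto
    then show "r \<le> norm B * K" using le[of u] u(1) by simp
  qed
  let ?u = "(1 / norm w) *\<^sub>R w"
  have "norm ?u \<le> 1" using False by simp
  then have "op_norm N norm (B ?u) \<in> {op_norm N norm (B u) | u. norm u \<le> 1}" by blast
  then have "op_norm N norm (B ?u) \<le> C"
    using cSup_upper[OF _ bdd] C unfolding op_norm_def[of norm] by (meson order_trans)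
  then have "norm (B ?u v) \<le> C * N v" by (rule op_norm_leD[OF N])
  then show ?thesis using False by (simp add: blinfun.scaleR_right blinfun.scaleR_left field_simps)
qed

lemma op_norm2_leI:
  fixes B :: "'w::real_normed_vector \<Rightarrow>\<^sub>L ('a::real_normed_vector \<Rightarrow>\<^sub>L 'b::real_normed_vector)"
  assumes N: "norm_like N" and C: "0 \<le> C" "\<And>w v. norm (B w v) \<le> C * norm w * N v"
  shows "op_norm norm (\<lambda>A. op_norm N norm (blinfun_apply A)) B \<le> C"
  using C by (intro op_norm_leI[OF norm_like_norm] op_norm_leI[OF N]) auto

section \<open>Charts and their differentials\<close>

lemma chart_atlas:
  assumes "smooth_atlas A" "c \<in> A"
  shows "open (cdom c)" "open (crange c)" "continuous_on (cdom c) (cmap c)"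
    "continuous_on (crange c) (cinv c)" "m \<in> cdom c \<Longrightarrow> cinv c (cmap c m) = m"
    "b \<in> crange c \<Longrightarrow> cinv c b \<in> cdom c" "b \<in> crange c \<Longrightarrow> cmap c (cinv c b) = b"
proof -
  have h: "homeomorphism (cdom c) (crange c) (cmap c) (cinv c)" and o: "open (cdom c)" "open (crange c)"
    using assms by (auto simp: smooth_atlas_def)
  show "open (cdom c)" "open (crange c)" by (fact o)+
  show "continuous_on (cdom c) (cmap c)" "continuous_on (crange c) (cinv c)"
    "m \<in> cdom c \<Longrightarrow> cinv c (cmap c m) = m"
    "b \<in> crange c \<Longrightarrow> cinv c b \<in> cdom c" "b \<in> crange c \<Longrightarrow> cmap c (cinv c b) = b"
    using h by (auto simp: homeomorphism_def)
qed

lemma chart_at: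
  assumes "smooth_atlas A"
  shows "chart_at A m \<in> A" "m \<in> cdom (chart_at A m)"
proof -
  have "\<exists>c. c \<in> A \<and> m \<in> cdom c" using assms by (auto simp: smooth_atlas_def)
  then have "chart_at A m \<in> A \<and> m \<in> cdom (chart_at A m)"
    unfolding chart_at_def by (rule someI_ex)
  then show "chart_at A m \<in> A" "m \<in> cdom (chart_at A m)" by auto
qed

lemma open_chart_preimage:
  assumes "smooth_atlas A" "c \<in> A"
  shows "open S \<Longrightarrow> open {b \<in> crange c. cinv c b \<in> S}" "open B \<Longrightarrow> open {m \<in> cdom c. cmap c m \<in> B}"
proof -
  assume "open S"
  then have "open (cinv c -` S \<inter> crange c)"
    using chart_atlas[OF assms] by (simp add: continuous_on_open_vimage)
  then show "open {b \<in> crange c. cinv c b \<in> S}" by (simp add: vimage_def Int_def conj_commute)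
next
  assume "open B"
  then have "open (cmap c -` B \<inter> cdom c)"
    using chart_atlas[OF assms] by (simp add: continuous_on_open_vimage)
  then show "open {m \<in> cdom c. cmap c m \<in> B}" by (simp add: vimage_def Int_def conj_commute)
qed

lemma smooth_on_differentiable: "\<lbrakk>smooth_on S h; a \<in> S\<rbrakk> \<Longrightarrow> h differentiable (at a)"
  unfolding smooth_on_def by (metis Ck_on.simps(2))

lemma smooth_on_continuous: "smooth_on S h \<Longrightarrow> continuous_on S h"
  unfolding smooth_on_def by (metis Ck_on.simps(1))

lemma transition_derivative:
  assumes A: "smooth_atlas A" "c \<in> A" "d \<in> A" "m \<in> cdom c" "m \<in> cdom d"
  shows "((cmap d \<circ> cinv c) has_derivative frechet_derivative (cmap d \<circ> cinv c) (at (cmap c m)))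
    (at (cmap c m))"
proof -
  have "smooth_on (cmap c ` (cdom c \<inter> cdom d)) (cmap d \<circ> cinv c)"
    using A by (auto simp: smooth_atlas_def)
  then show ?thesis
    using A smooth_on_differentiable frechet_derivative_works by blast
qed

text \<open>The two transition maps compose to the identity near the point; the chain rule and
  uniqueness of the derivative do the rest.\<close>

lemma transition_derivative_inverse:
  assumes A: "smooth_atlas A" "c \<in> A" "d \<in> A" "m \<in> cdom c" "m \<in> cdom d"
  shows "frechet_derivative (cmap c \<circ> cinv d) (at (cmap d m))
    (frechet_derivative (cmap d \<circ> cinv c) (at (cmap c m)) v) = v"
proof -
  note c = chart_atlas[OF A(1,2)] and d = chart_atlas[OF A(1,3)]
  let ?\<tau> = "cmap d \<circ> cinv c" and ?\<sigma> = "cmap c \<circ> cinv d"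
  have eq: "?\<tau> (cmap c m) = cmap d m" using c A by simp
  have "(?\<sigma> \<circ> ?\<tau> has_derivative frechet_derivative ?\<sigma> (at (cmap d m)) \<circ> frechet_derivative ?\<tau> (at (cmap c m)))
      (at (cmap c m))"
    using transition_derivative[OF A] transition_derivative[OF A(1,3,2,5,4)] eq
    by (intro diff_chain_at) auto
  moreover have "(?\<sigma> \<circ> ?\<tau> has_derivative id) (at (cmap c m))"
  proof (rule has_derivative_transform_within_open[OF has_derivative_id])
    show "open {b \<in> crange c. cinv c b \<in> cdom d}"
      using open_chart_preimage(1)[OF A(1,2) d(1)] .
    show "cmap c m \<in> {b \<in> crange c. cinv c b \<in> cdom d}" using A c by auto
    show "id b = (?\<sigma> \<circ> ?\<tau>) b" if "b \<in> {b \<in> crange c. cinv c b \<in> cdom d}" for b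
      using that c(7)[of b] d(5)[of "cinv c b"] by auto
  qed
  ultimately have "frechet_derivative ?\<sigma> (at (cmap d m)) \<circ> frechet_derivative ?\<tau> (at (cmap c m)) = id"
    by (rule has_derivative_unique)
  then show ?thesis by (simp add: fun_eq_iff)
qed

text \<open>\<open>Blinfun\<close> is faithful only on bounded linear maps; differentiability of the
  transition map supplies this.\<close>

lemma chart_diff_inv_apply:
  assumes "smooth_atlas A" "c \<in> A" "m \<in> cdom c"
  shows "chart_diff_inv A c m v =
    frechet_derivative (cmap (chart_at A m) \<circ> cinv c) (at (cmap c m)) v"
  unfolding chart_diff_inv_def
  using transition_derivative[OF assms(1,2) chart_at(1)[OF assms(1)] assms(3) chart_at(2)[OF assms(1)]]
  by (simp add: bounded_linear_Blinfun_apply has_derivative_bounded_linear)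

lemma chart_diff_inv_bij:
  assumes A: "smooth_atlas A" "c \<in> A" "m \<in> cdom c"
  shows "inj (chart_diff_inv A c m)" "surj (chart_diff_inv A c m)"
proof -
  note * = chart_diff_inv_apply[OF A]
    transition_derivative_inverse[OF A(1,2) chart_at(1)[OF A(1)] A(3) chart_at(2)[OF A(1)]]
    transition_derivative_inverse[OF A(1) chart_at(1)[OF A(1)] A(2) chart_at(2)[OF A(1)] A(3)]
  show "inj (chart_diff_inv A c m)" by (rule injI) (metis *(1,2))
  show "surj (chart_diff_inv A c m)" unfolding surj_def by (metis *(1,3))
qed

text \<open>Tangent vectors at \<open>m\<close> are by convention coordinates in the preferred chart
  at \<open>m\<close>.\<close>

lemma chart_diff_chart_at:
  assumes "smooth_atlas A"
  shows "chart_diff A (chart_at A m) m v = v"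
proof -
  let ?c = "chart_at A m"
  note c = chart_atlas[OF assms chart_at(1)[OF assms, of m]]
  have "(cmap ?c \<circ> cinv ?c has_derivative id) (at (cmap ?c m))"
    by (rule has_derivative_transform_within_open[OF has_derivative_id c(2)])
      (use c chart_at(2)[OF assms, of m] in auto)
  then have "frechet_derivative (cmap ?c \<circ> cinv ?c) (at (cmap ?c m)) = id"
    by (metis frechet_derivative_at)
  then show ?thesis
    by (simp add: chart_diff_def tangent_deriv_def bounded_linear_Blinfun_apply id_def bounded_linear_ident)
qed

section \<open>Riemannian norm against coordinate norm\<close>

text \<open>Read in the fixed chart \<open>c\<close>, the metric is continuous in point and vector
  jointly, and positive on the compact product of \<open>K\<close> with the unit sphere. Its minimum
  there extends to all vectors by homogeneity.\<close>

lemma rnorm_chart_lower_bound: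
  fixes A :: "('m::{t2_space,second_countable_topology}, 'e::{real_normed_vector,heine_borel}) chart set"
  assumes A: "smooth_atlas A" "c \<in> A" and g: "riemannian_metric A g"
    and K: "compact K" "K \<subseteq> crange c"
  shows "\<exists>k>0. \<forall>b\<in>K. \<forall>w. k * norm w \<le> rnorm g (cinv c b) (chart_diff_inv A c (cinv c b) w)"
proof -
  let ?P = "\<lambda>b. chart_diff_inv A c (cinv c b)"
  let ?q = "\<lambda>b w. g (cinv c b) (?P b w) (?P b w)"
  have bil: "bilinear (g m)" and pos: "v \<noteq> 0 \<Longrightarrow> g m v v > 0" for m v
    using g by (auto simp: riemannian_metric_def)
  have g0: "g m 0 0 = 0" for m using bilinear_lzero[OF bil] .
  have nonneg: "0 \<le> rnorm g m v" for m v
    using pos[of v m] g0[of m] by (cases "v = 0") (auto simp: rnorm_def)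
  have cont: "continuous_on (K \<times> sphere 0 1) (\<lambda>(b, w). ?q b w)"
  proof -
    have "continuous_on (crange c \<times> UNIV \<times> UNIV) (\<lambda>(a, v, w). g (cinv c a) (?P a v) (?P a w))"
      using g A by (intro smooth_on_continuous) (auto simp: riemannian_metric_def)
    then have "continuous_on (K \<times> sphere 0 1)
        (\<lambda>p. (\<lambda>(a, v, w). g (cinv c a) (?P a v) (?P a w)) (fst p, snd p, snd p))"
    proof (rule continuous_on_compose2)
      show "continuous_on (K \<times> sphere 0 1) (\<lambda>p::'e \<times> 'e. (fst p, snd p, snd p))"
        by (intro continuous_intros)
    qed (use K(2) in auto)
    then show ?thesis by (simp add: case_prod_unfold)
  qed
  have P0: "?P b w \<noteq> 0" if "b \<in> K" "w \<noteq> 0" for b w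
    using injD[OF chart_diff_inv_bij(1)[OF A, of "cinv c b"], of w 0] that K(2) chart_atlas(6)[OF A]
    by auto
  obtain k where k: "k > 0" "\<And>b w. b \<in> K \<Longrightarrow> w \<in> sphere 0 1 \<Longrightarrow> k \<le> ?q b w"
  proof (cases "K \<times> (sphere 0 1 :: 'e set) = {}")
    \<comment> \<open>Covers a zero-dimensional model space, whose unit sphere is empty, as well as
      empty \<open>K\<close>; any positive constant will do.\<close>
    case True
    then show thesis using that[OF zero_less_one] by blast
  next
    case False
    have "bounded (sphere 0 1 :: 'e set)" "closed (sphere 0 1 :: 'e set)"
      by (auto simp: bounded_iff sphere_def intro!: closed_Collect_eq continuous_intros)
    then have "compact (sphere 0 1 :: 'e set)" by (simp add: compact_eq_bounded_closed)
    then have "compact (K \<times> (sphere 0 1 :: 'e set))" using K(1) by (intro compact_Times)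
    from continuous_attains_inf[OF this False cont]
    obtain b w where bw: "b \<in> K" "w \<in> sphere 0 1"
      "\<forall>p\<in>K \<times> sphere 0 1. ?q b w \<le> (case p of (b, w) \<Rightarrow> ?q b w)" by auto
    have "0 < ?q b w" using bw by (intro pos P0) auto
    then show thesis using that[of "?q b w"] bw(3) by auto
  qed
  have "sqrt k * norm w \<le> rnorm g (cinv c b) (?P b w)" if b: "b \<in> K" for b w
  proof (cases "w = 0")
    case True
    then show ?thesis using nonneg by simp
  next
    case False
    define u where "u = (1 / norm w) *\<^sub>R w"
    have "w = norm w *\<^sub>R u" using False by (simp add: u_def)
    then have "?q b w = ?q b (norm w *\<^sub>R u)" by metis
    also have "\<dots> = (norm w)\<^sup>2 * ?q b u"
      by (simp add: blinfun.scaleR_right bilinear_lmul[OF bil] bilinear_rmul[OF bil] power2_eq_square)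
    also have "\<dots> \<ge> (norm w)\<^sup>2 * k"
      using k(2)[OF b, of u] False by (intro mult_left_mono) (auto simp: u_def)
    finally have "sqrt ((norm w)\<^sup>2 * k) \<le> rnorm g (cinv c b) (?P b w)"
      unfolding rnorm_def by (rule real_sqrt_le_mono)
    then show ?thesis by (simp add: real_sqrt_mult mult.commute)
  qed
  then show ?thesis using k(1) by (intro exI[of _ "sqrt k"]) auto
qed

lemma norm_like_rnorm:
  fixes A :: "('m::{t2_space,second_countable_topology}, 'e::{real_normed_vector,heine_borel}) chart set"
  assumes A: "smooth_atlas A" and g: "riemannian_metric A g"
  shows "norm_like (rnorm g m)"
proof -
  let ?c = "chart_at A m"
  note c = chart_at[OF A, of m]
  let ?P = "chart_diff_inv A ?c m"
  have bil: "bilinear (g m)" and pos: "\<And>v. v \<noteq> 0 \<Longrightarrow> g m v v > 0"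
    using g by (auto simp: riemannian_metric_def)
  have "\<exists>k>0. \<forall>b\<in>{cmap ?c m}. \<forall>w. k * norm w \<le> rnorm g (cinv ?c b) (chart_diff_inv A ?c (cinv ?c b) w)"
    using c by (intro rnorm_chart_lower_bound[OF A _ g]) auto
  then obtain k where k: "k > 0" "\<And>w. k * norm w \<le> rnorm g m (?P w)"
    using chart_atlas(5)[OF A c] by auto
  have "norm v \<le> (norm ?P / k) * rnorm g m v" for v
  proof -
    obtain w where w: "v = ?P w" using chart_diff_inv_bij(2)[OF A c] by (auto simp: surj_def)
    have "norm v \<le> norm ?P * norm w" unfolding w by (rule norm_blinfun)
    also have "\<dots> \<le> norm ?P * (rnorm g m v / k)"
      using k(2)[of w] k(1) w by (intro mult_left_mono) (auto simp: field_simps)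
    finally show ?thesis by simp
  qed
  moreover have "rnorm g m (a *\<^sub>R v) = \<bar>a\<bar> * rnorm g m v" for a v
    by (simp add: rnorm_def bilinear_lmul[OF bil] bilinear_rmul[OF bil] real_sqrt_mult
        flip: mult.assoc)
  moreover have "v \<noteq> 0 \<Longrightarrow> 0 < rnorm g m v" for v using pos by (simp add: rnorm_def)
  ultimately show ?thesis
    unfolding norm_like_def using k(1) by (intro conjI allI impI exI[of _ "norm ?P / k"]) auto
qed

text \<open>In a chart around \<open>m0\<close> the map \<open>U(m1, -)\<close> is continuous, hence
  bounded on a closed coordinate ball, and there the Riemannian norm dominates the coordinate norm
  uniformly. The target point \<open>m1\<close> stays fixed, so the ambient norm is harmless on the
  left-hand side.\<close>

lemma parallelism_locally_bounded:
  fixes A :: "('m::{t2_space,second_countable_topology}, 'e::{real_normed_vector,heine_borel}) chart set"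
  assumes A: "smooth_atlas A" and g: "riemannian_metric A g" and G: "is_gauge A G"
    and m: "(m1, m0) \<in> gdom G"
  shows "\<exists>S K. open S \<and> m0 \<in> S \<and> 0 \<le> K \<and> (\<forall>m\<in>S. \<forall>v. norm (gpar G m1 m v) \<le> K * rnorm g m v)"
proof -
  define c d where "c = chart_at A m1" and "d = chart_at A m0"
  have c: "c \<in> A" "m1 \<in> cdom c" and d: "d \<in> A" "m0 \<in> cdom d"
    using chart_at[OF A] by (auto simp: c_def d_def)
  note ca = chart_atlas[OF A c(1)] and da = chart_atlas[OF A d(1)]
  define B where "B = {b \<in> crange d. cinv d b \<in> {m. (m1, m) \<in> gdom G}}"
  have "open ((\<lambda>m. (m1, m)) -` gdom G)"
    using G by (intro open_vimage continuous_intros) (auto simp: is_gauge_def diagonal_domain_def)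
  then have "open {m. (m1, m) \<in> gdom G}" by (simp add: vimage_def)
  then have "open B" unfolding B_def by (rule open_chart_preimage(1)[OF A d(1)])
  moreover have "cmap d m0 \<in> B" using m d da by (auto simp: B_def)
  ultimately obtain r where r: "r > 0" "cball (cmap d m0) r \<subseteq> B" by (meson open_contains_cball)
  define h where "h b = chart_diff A c m1 o\<^sub>L gpar G m1 (cinv d b) o\<^sub>L chart_diff_inv A d (cinv d b)" for b
  have "continuous_on (coord_dom (gdom G) c d) (\<lambda>(a, b). chart_diff A c (cinv c a) o\<^sub>L
      gpar G (cinv c a) (cinv d b) o\<^sub>L chart_diff_inv A d (cinv d b))"
    using G c d by (intro smooth_on_continuous) (auto simp: is_gauge_def parallelism_on_def)
  then have "continuous_on B (\<lambda>b. (\<lambda>(a, b). chart_diff A c (cinv c a) o\<^sub>L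
      gpar G (cinv c a) (cinv d b) o\<^sub>L chart_diff_inv A d (cinv d b)) (cmap c m1, b))"
  proof (rule continuous_on_compose2)
    show "continuous_on B (\<lambda>b. (cmap c m1, b))" by (intro continuous_intros)
  qed (use c ca in \<open>auto simp: B_def coord_dom_def\<close>)
  then have "continuous_on B h" using c ca by (simp add: h_def[abs_def])
  then have "bounded (h ` cball (cmap d m0) r)"
    using r by (intro compact_imp_bounded compact_continuous_image compact_cball)
      (auto intro: continuous_on_subset)
  then obtain H where H: "H > 0" "\<And>b. b \<in> cball (cmap d m0) r \<Longrightarrow> norm (h b) \<le> H"
    unfolding bounded_pos by auto
  have "\<exists>k>0. \<forall>b\<in>cball (cmap d m0) r. \<forall>w. k * norm w \<le> rnorm g (cinv d b) (chart_diff_inv A d (cinv d b) w)"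
    using r by (intro rnorm_chart_lower_bound[OF A d(1) g] compact_cball) (auto simp: B_def)
  then obtain k where k: "k > 0" "\<And>b w. b \<in> cball (cmap d m0) r
      \<Longrightarrow> k * norm w \<le> rnorm g (cinv d b) (chart_diff_inv A d (cinv d b) w)" by blast
  define S where "S = {m \<in> cdom d. cmap d m \<in> ball (cmap d m0) r}"
  have "norm (gpar G m1 m v) \<le> H / k * rnorm g m v" if "m \<in> S" for m v
  proof -
    have b: "cmap d m \<in> cball (cmap d m0) r" "cinv d (cmap d m) = m" "m \<in> cdom d"
      using that da by (auto simp: S_def)
    obtain w where w: "v = chart_diff_inv A d m w"
      using chart_diff_inv_bij(2)[OF A d(1) b(3)] by (auto simp: surj_def)
    \<comment> \<open>The chart \<open>c\<close> is the preferred one at \<open>m1\<close>, so its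
      differential there is the identity.\<close>
    have "gpar G m1 m v = h (cmap d m) w"
      by (simp add: h_def b w c_def chart_diff_chart_at[OF A])
    also have "norm \<dots> \<le> H * norm w"
      using H(2)[OF b(1)] by (intro order_trans[OF norm_blinfun] mult_right_mono) auto
    also have "\<dots> \<le> H * (rnorm g m v / k)"
      using k(2)[OF b(1), of w] k(1) H(1) w b(2) by (intro mult_left_mono) (auto simp: field_simps)
    finally show ?thesis by simp
  qed
  moreover have "open S" unfolding S_def by (rule open_chart_preimage(2)[OF A d(1) open_ball])
  moreover have "m0 \<in> S" using d r by (simp add: S_def)
  ultimately show ?thesis using H(1) k(1) by (intro exI[of _ S] exI[of _ "H / k"]) auto
qed

section \<open>Products of one-forms along a path\<close>

text \<open>Both relations of a controlled one-form at a single pair of times, as pointwise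
  inequalities with a common constant; this keeps suprema out of the later estimates.\<close>

definition one_form_estimate :: "('k::finite) rough_path \<Rightarrow> ('m \<Rightarrow> 'e \<Rightarrow> 'e \<Rightarrow> real) \<Rightarrow>
    ('m, 'e::real_normed_vector) gauge \<Rightarrow> (real \<Rightarrow> 'm) \<Rightarrow> real \<Rightarrow>
    (real \<Rightarrow> 'e \<Rightarrow>\<^sub>L 'v::real_normed_vector) \<Rightarrow> (real \<Rightarrow> (real^'k) \<Rightarrow>\<^sub>L ('e \<Rightarrow>\<^sub>L 'v)) \<Rightarrow>
    real \<Rightarrow> real \<Rightarrow> bool" where
  "one_form_estimate X g G y C \<alpha> \<alpha>' s t \<longleftrightarrow> (y t, y s) \<in> gdom G \<and>
     (\<forall>v. norm (\<alpha> t (gpar G (y t) (y s) v) - \<alpha> s v - \<alpha>' s (rpx X t - rpx X s) v)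
        \<le> C * (rho X s t)\<^sup>2 * rnorm g (y s) v) \<and>
     (\<forall>w v. norm (\<alpha>' t w (gpar G (y t) (y s) v) - \<alpha>' s w v) \<le> C * rho X s t * norm w * rnorm g (y s) v)"

lemma CRP_along_iff:
  fixes \<alpha> :: "real \<Rightarrow> 'e::real_normed_vector \<Rightarrow>\<^sub>L 'v::real_normed_vector"
  assumes N: "\<And>m. norm_like (rnorm g m)"
  shows "(\<alpha>, \<alpha>') \<in> CRP_along X g G y \<longleftrightarrow>
    \<alpha> \<in> extensional {0..rpT X} \<and> \<alpha>' \<in> extensional {0..rpT X} \<and>
    (\<exists>C\<ge>0. \<exists>\<delta>>0. \<forall>s t. 0 \<le> s \<longrightarrow> s \<le> t \<longrightarrow> t \<le> rpT X \<longrightarrow> t - s \<le> \<delta> \<longrightarrow>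
      one_form_estimate X g G y C \<alpha> \<alpha>' s t)"
    (is "_ \<longleftrightarrow> ?ext \<and> ?ext' \<and> ?est")
proof -
  define F1 where "F1 s t = (\<alpha> t o\<^sub>L gpar G (y t) (y s)) - \<alpha> s - \<alpha>' s (rpx X t - rpx X s)" for s t
  define F2 where "F2 s t = pre_comp (\<alpha>' t) (gpar G (y t) (y s)) - \<alpha>' s" for s t
  define n1 where "n1 s B = op_norm (rnorm g (y s)) norm (blinfun_apply B)" for s and B :: "'e \<Rightarrow>\<^sub>L 'v"
  define n2 where "n2 s B = op_norm norm (\<lambda>C. op_norm (rnorm g (y s)) norm (blinfun_apply C)) (blinfun_apply B)"
    for s and B :: "(real^'b) \<Rightarrow>\<^sub>L ('e \<Rightarrow>\<^sub>L 'v)"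
  let ?ok = "\<lambda>s t. (y t, y s) \<in> gdom G"
  have F1: "F1 s t v = \<alpha> t (gpar G (y t) (y s) v) - \<alpha> s v - \<alpha>' s (rpx X t - rpx X s) v" for s t v
    by (simp add: F1_def blinfun.diff_left)
  have F2: "F2 s t w v = \<alpha>' t w (gpar G (y t) (y s) v) - \<alpha>' s w v" for s t w v
    by (simp add: F2_def blinfun.diff_left)
  have "(\<alpha>, \<alpha>') \<in> CRP_along X g G y \<longleftrightarrow> ?ext \<and> ?ext' \<and>
      approx X 2 ?ok n1 F1 (\<lambda>_ _. 0) \<and> approx X 1 ?ok n2 F2 (\<lambda>_ _. 0)"
    by (simp add: CRP_along_def F1_def[abs_def] F2_def[abs_def] n1_def[abs_def] n2_def[abs_def])
  moreover have "approx X 2 ?ok n1 F1 (\<lambda>_ _. 0) \<and> approx X 1 ?ok n2 F2 (\<lambda>_ _. 0) \<longleftrightarrow> ?est"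
  proof
    assume "approx X 2 ?ok n1 F1 (\<lambda>_ _. 0) \<and> approx X 1 ?ok n2 F2 (\<lambda>_ _. 0)"
    then have 1: "approx X 2 ?ok n1 F1 (\<lambda>_ _. 0)" and 2: "approx X 1 ?ok n2 F2 (\<lambda>_ _. 0)" by auto
    obtain C1 \<delta>1 where C1: "0 \<le> C1" "0 < \<delta>1"
      "\<And>s t. \<lbrakk>0 \<le> s; s \<le> t; t \<le> rpT X; t - s \<le> \<delta>1\<rbrakk>
        \<Longrightarrow> ?ok s t \<and> n1 s (F1 s t - 0) \<le> C1 * rp\<omega> X s t powr (2 / rpp X)"
      using approxD[OF 1] by blast
    obtain C2 \<delta>2 where C2: "0 \<le> C2" "0 < \<delta>2"
      "\<And>s t. \<lbrakk>0 \<le> s; s \<le> t; t \<le> rpT X; t - s \<le> \<delta>2\<rbrakk>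
        \<Longrightarrow> ?ok s t \<and> n2 s (F2 s t - 0) \<le> C2 * rp\<omega> X s t powr (1 / rpp X)"
      using approxD[OF 2] by blast
    have "one_form_estimate X g G y (C1 + C2) \<alpha> \<alpha>' s t"
      if "0 \<le> s" "s \<le> t" "t \<le> rpT X" "t - s \<le> min \<delta>1 \<delta>2" for s t
      unfolding one_form_estimate_def
    proof (intro conjI allI)
      show "?ok s t" using C1(3)[of s t] that by simp
      have "n1 s (F1 s t) \<le> (C1 + C2) * (rho X s t)\<^sup>2"
        using C1(3)[of s t] C2(1) that unfolding distrib_right by (simp add: powr_eq_rho add_increasing2)
      from op_norm_leD[OF N this[unfolded n1_def]]
      show "norm (\<alpha> t (gpar G (y t) (y s) v) - \<alpha> s v - \<alpha>' s (rpx X t - rpx X s) v)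
        \<le> (C1 + C2) * (rho X s t)\<^sup>2 * rnorm g (y s) v" for v unfolding F1 .
      have "n2 s (F2 s t) \<le> (C1 + C2) * rho X s t"
        using C2(3)[of s t] C1(1) that unfolding distrib_right by (simp add: powr_eq_rho add_increasing)
      from op_norm2_leD[OF N this[unfolded n2_def]]
      show "norm (\<alpha>' t w (gpar G (y t) (y s) v) - \<alpha>' s w v)
        \<le> (C1 + C2) * rho X s t * norm w * rnorm g (y s) v" for w v unfolding F2 .
    qed
    then show ?est using C1(1,2) C2(1,2)
      by (intro exI[of _ "C1 + C2"] conjI exI[of _ "min \<delta>1 \<delta>2"]) auto
  next
    assume ?est
    then obtain C \<delta> where C: "0 \<le> C" "0 < \<delta>"
      "\<And>s t. \<lbrakk>0 \<le> s; s \<le> t; t \<le> rpT X; t - s \<le> \<delta>\<rbrakk> \<Longrightarrow> one_form_estimate X g G y C \<alpha> \<alpha>' s t" by blast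
    have "n1 s (F1 s t - 0) \<le> C * rp\<omega> X s t powr (2 / rpp X)"
      "n2 s (F2 s t - 0) \<le> C * rp\<omega> X s t powr (1 / rpp X)"
      if "one_form_estimate X g G y C \<alpha> \<alpha>' s t" for s t
      using that C(1) unfolding n1_def n2_def one_form_estimate_def powr_eq_rho
      by (auto simp: F1 F2 intro!: op_norm_leI[OF N] op_norm2_leI[OF N])
    moreover have "one_form_estimate X g G y C \<alpha> \<alpha>' s t \<Longrightarrow> ?ok s t" for s t
      by (simp add: one_form_estimate_def)
    ultimately show "approx X 2 ?ok n1 F1 (\<lambda>_ _. 0) \<and> approx X 1 ?ok n2 F2 (\<lambda>_ _. 0)"
      using C(3) by (intro conjI approxI[OF C(2)]) blast+
  qed
  ultimately show ?thesis by blast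
qed

definition one_form_bound :: "('m \<Rightarrow> 'e \<Rightarrow> 'e \<Rightarrow> real) \<Rightarrow> (real \<Rightarrow> 'm) \<Rightarrow> real \<Rightarrow>
    (real \<Rightarrow> 'e::real_normed_vector \<Rightarrow>\<^sub>L 'v::real_normed_vector) \<Rightarrow>
    (real \<Rightarrow> (real^'k::finite) \<Rightarrow>\<^sub>L ('e \<Rightarrow>\<^sub>L 'v)) \<Rightarrow> real \<Rightarrow> bool" where
  "one_form_bound g y K \<alpha> \<alpha>' s \<longleftrightarrow> (\<forall>v. norm (\<alpha> s v) \<le> K * rnorm g (y s) v) \<and>
     (\<forall>w v. norm (\<alpha>' s w v) \<le> K * norm w * rnorm g (y s) v)"

text \<open>Bounds travel backwards in time: \<open>v\<close> is sent to the later tangent space by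
  \<open>U\<close>, where the ordinary operator norm at the single time \<open>t\<close> suffices.
  The derivative \<open>\<alpha>'\<close> comes before \<open>\<alpha>\<close>, since its bound
  \<open>B\<close> is needed for the first-order term in the expansion of \<open>\<alpha>\<close>.
  The final constant is a sum so that it serves both.\<close>

lemma one_form_bound_transport:
  fixes \<alpha> :: "real \<Rightarrow> 'e::real_normed_vector \<Rightarrow>\<^sub>L 'v::real_normed_vector"
  assumes X: "weak_geometric_rough_path X" and N: "\<And>m. norm_like (rnorm g m)"
    and est: "one_form_estimate X g G y C \<alpha> \<alpha>' s t" and C: "0 \<le> C"
    and st: "0 \<le> s" "s \<le> t" "t \<le> rpT X"
    and U: "\<And>v. norm (gpar G (y t) (y s) v) \<le> K * rnorm g (y s) v" and K: "0 \<le> K"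
    and R: "R = rho X 0 (rpT X)" and B: "B = norm (\<alpha>' t) * K + C * R"
  shows "one_form_bound g y (norm (\<alpha> t) * K + B * R + C * R\<^sup>2 + B) \<alpha> \<alpha>' s"
proof -
  let ?U = "gpar G (y t) (y s)" and ?N = "rnorm g (y s)" and ?x = "rpx X t - rpx X s" and ?r = "rho X s t"
  have N0: "0 \<le> ?N v" for v by (rule norm_like_nonneg[OF N])
  have r: "0 \<le> R" "?r \<le> R" using st rho_mono[OF X, of 0 s t "rpT X"] by (auto simp: R)
  have B0: "0 \<le> B" using K C r by (simp add: B)
  have 1: "norm (\<alpha>' s w v) \<le> B * norm w * ?N v" for w v
  proof -
    have "norm (\<alpha>' t w (?U v)) \<le> (norm (\<alpha>' t) * norm w) * (K * ?N v)"
      by (intro order_trans[OF norm_blinfun] mult_mono norm_blinfun U) auto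
    moreover have "norm (\<alpha>' t w (?U v) - \<alpha>' s w v) \<le> C * ?r * norm w * ?N v"
      using est by (simp add: one_form_estimate_def)
    moreover have "C * ?r * norm w * ?N v \<le> C * R * norm w * ?N v"
      using N0 C r by (intro mult_right_mono mult_left_mono) auto
    moreover have "norm (\<alpha>' s w v) \<le> norm (\<alpha>' t w (?U v)) + norm (\<alpha>' t w (?U v) - \<alpha>' s w v)"
      using norm_triangle_ineq4[of "\<alpha>' t w (?U v)" "\<alpha>' t w (?U v) - \<alpha>' s w v"] by simp
    ultimately show ?thesis unfolding B by (simp add: algebra_simps)
  qed
  have 2: "norm (\<alpha> s v) \<le> (norm (\<alpha> t) * K + B * R + C * R\<^sup>2) * ?N v" for v
  proof -
    have "norm (\<alpha> t (?U v)) \<le> norm (\<alpha> t) * (K * ?N v)"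
      by (intro order_trans[OF norm_blinfun] mult_left_mono U) auto
    moreover have "norm (\<alpha> t (?U v) - \<alpha> s v - \<alpha>' s ?x v) \<le> C * ?r\<^sup>2 * ?N v"
      using est by (simp add: one_form_estimate_def)
    moreover have "C * ?r\<^sup>2 * ?N v \<le> C * R\<^sup>2 * ?N v"
      using N0 C r by (intro mult_right_mono mult_left_mono power_mono) auto
    moreover have "norm (\<alpha>' s ?x v) \<le> B * R * ?N v"
      using 1[of ?x v] norm_increment_le(1)[OF X st] r N0 B0
      by (elim order_trans) (intro mult_right_mono mult_left_mono, auto)
    moreover have "norm (\<alpha> s v) \<le> norm (\<alpha> t (?U v)) + norm (\<alpha> t (?U v) - \<alpha> s v - \<alpha>' s ?x v) + norm (\<alpha>' s ?x v)"
      using norm_triangle_ineq4[of "\<alpha> t (?U v)" "\<alpha> t (?U v) - \<alpha> s v - \<alpha>' s ?x v + \<alpha>' s ?x v"]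
        norm_triangle_ineq[of "\<alpha> t (?U v) - \<alpha> s v - \<alpha>' s ?x v" "\<alpha>' s ?x v"] by simp
    ultimately show ?thesis by (simp add: algebra_simps)
  qed
  have A: "0 \<le> norm (\<alpha> t) * K + B * R + C * R\<^sup>2" using K C r B0 by simp
  show ?thesis
    unfolding one_form_bound_def
  proof (intro conjI allI)
    fix v
    show "norm (\<alpha> s v) \<le> (norm (\<alpha> t) * K + B * R + C * R\<^sup>2 + B) * ?N v"
      using 2[of v] mult_nonneg_nonneg[OF B0 N0[of v]] by (simp add: distrib_right)
    show "norm (\<alpha>' s w v) \<le> (norm (\<alpha> t) * K + B * R + C * R\<^sup>2 + B) * norm w * ?N v" for w
      using 1[of w v] mult_nonneg_nonneg[OF mult_nonneg_nonneg[OF A norm_ge_zero[of w]] N0[of v]]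
      by (simp add: distrib_right)
  qed
qed

text \<open>Near every time one reference time to the right gives a uniform bound; the Bolzano
  principle patches these local bounds over \<open>[0,T]\<close>, adding the constants of adjacent
  intervals.\<close>

lemma CRP_along_bounded:
  fixes A :: "('m::{t2_space,second_countable_topology}, 'e::{real_normed_vector,heine_borel}) chart set"
    and \<alpha> :: "real \<Rightarrow> 'e \<Rightarrow>\<^sub>L 'v::real_normed_vector"
  assumes X: "weak_geometric_rough_path X"
    and A: "smooth_atlas A" and g: "riemannian_metric A g" and G: "is_gauge A G"
    and y: "continuous_on {0..rpT X} y" and \<alpha>: "(\<alpha>, \<alpha>') \<in> CRP_along X g G y"
  shows "\<exists>K\<ge>0. \<forall>s. 0 \<le> s \<longrightarrow> s \<le> rpT X \<longrightarrow> one_form_bound g y K \<alpha> \<alpha>' s"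
proof -
  let ?T = "rpT X"
  have N: "norm_like (rnorm g m)" for m by (rule norm_like_rnorm[OF A g])
  obtain C \<delta> where C: "0 \<le> C" "0 < \<delta>" "\<And>s t. \<lbrakk>0 \<le> s; s \<le> t; t \<le> ?T; t - s \<le> \<delta>\<rbrakk>
      \<Longrightarrow> one_form_estimate X g G y C \<alpha> \<alpha>' s t"
    using \<alpha> unfolding CRP_along_iff[OF N] by blast
  \<comment> \<open>The intersection with \<open>[0,T]\<close> is there because the local intervals
    of the Bolzano principle may stick out at the ends.\<close>
  define P where "P a b \<longleftrightarrow> (\<exists>K\<ge>0. \<forall>s\<in>{a..b} \<inter> {0..?T}. one_form_bound g y K \<alpha> \<alpha>' s)" for a b
  have mono: "one_form_bound g y K' \<alpha> \<alpha>' s" if "one_form_bound g y K \<alpha> \<alpha>' s" "K \<le> K'" for K K' s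
  proof -
    have "K * rnorm g (y s) v \<le> K' * rnorm g (y s) v"
      "K * norm w * rnorm g (y s) v \<le> K' * norm w * rnorm g (y s) v" for v and w :: "real^'c"
      using that(2) norm_like_nonneg[OF N] by (auto intro!: mult_right_mono)
    then show ?thesis using that(1) unfolding one_form_bound_def by (meson order_trans)
  qed
  have "0 \<le> ?T" using rough_path_basics(1)[OF X] by simp
  then have "P 0 ?T"
  proof (induction rule: Bolzano)
    case (trans a b c)
    then obtain K1 K2 where K: "0 \<le> K1" "0 \<le> K2"
      "\<And>s. s \<in> {a..b} \<inter> {0..?T} \<Longrightarrow> one_form_bound g y K1 \<alpha> \<alpha>' s"
      "\<And>s. s \<in> {b..c} \<inter> {0..?T} \<Longrightarrow> one_form_bound g y K2 \<alpha> \<alpha>' s" unfolding P_def by meson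
    have "one_form_bound g y (K1 + K2) \<alpha> \<alpha>' s" if "s \<in> {a..c} \<inter> {0..?T}" for s
      using K(3)[of s] K(4)[of s] that mono[of K1 s "K1 + K2"] mono[of K2 s "K1 + K2"] K(1,2)
      by (cases "s \<le> b") auto
    then show ?case unfolding P_def using K(1,2) by (intro exI[of _ "K1 + K2"]) auto
  next
    case (local x)
    \<comment> \<open>Late enough to lie to the right of every \<open>s\<close> in
      \<open>[0,T]\<close> within \<open>\<delta> / 2\<close> of \<open>x\<close>, and close enough
      that \<open>t - s \<le> \<delta>\<close>. Near the right end it is \<open>T\<close>
      itself.\<close>
    define t where "t = min ?T (x + \<delta> / 2)"
    have t: "0 \<le> t" "t \<le> ?T" "x \<le> t" "t \<le> x + \<delta> / 2" using local C(2) by (auto simp: t_def)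
    have "(y t, y x) \<in> gdom G" using C(3)[of x t] local t C(2) by (auto simp: one_form_estimate_def)
    from parallelism_locally_bounded[OF A g G this]
    obtain S K where S: "open S" "y x \<in> S" and K: "0 \<le> K"
      "\<And>m v. m \<in> S \<Longrightarrow> norm (gpar G (y t) m v) \<le> K * rnorm g m v" by blast
    obtain S' where S': "open S'" "x \<in> S'" "\<And>s. \<lbrakk>s \<in> {0..?T}; s \<in> S'\<rbrakk> \<Longrightarrow> y s \<in> S"
      using y S local unfolding continuous_on_topological by (metis atLeastAtMost_iff)
    obtain e where e: "0 < e" "\<And>s. \<bar>s - x\<bar> < e \<Longrightarrow> s \<in> S'"
      using S'(1,2) unfolding open_dist by (metis dist_real_def)
    define R where "R = rho X 0 ?T"
    define B where "B = norm (\<alpha>' t) * K + C * R"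
    define L where "L = norm (\<alpha> t) * K + B * R + C * R\<^sup>2 + B"
    have "R \<ge> 0" by (simp add: R_def)
    then have "L \<ge> 0" using K(1) C(1) by (simp add: L_def B_def)
    have bound: "one_form_bound g y L \<alpha> \<alpha>' s" if "\<bar>s - x\<bar> < min e (\<delta> / 2)" "0 \<le> s" "s \<le> ?T" for s
      unfolding L_def
    proof (rule one_form_bound_transport[where X = X and G = G and t = t and C = C and K = K])
      have sx: "\<bar>s - x\<bar> < \<delta> / 2" using that by simp
      show "s \<le> t" unfolding t_def using sx that by (intro min.boundedI) (linarith+)
      moreover have "t - s \<le> \<delta>" using sx t by linarith
      ultimately show "one_form_estimate X g G y C \<alpha> \<alpha>' s t" using that t by (intro C(3)) auto
      show "norm (gpar G (y t) (y s) v) \<le> K * rnorm g (y s) v" for v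
        using that by (intro K(2) S'(3) e(2)) auto
    qed (use X N C(1) K(1) R_def B_def that(2) t(2) in auto)
    have "P a b" if "a \<le> x" "x \<le> b" "b - a < min e (\<delta> / 2)" for a b
    proof -
      have "\<bar>s - x\<bar> < min e (\<delta> / 2)" if "s \<in> {a..b}" for s
        using that \<open>a \<le> x\<close> \<open>x \<le> b\<close> \<open>b - a < min e (\<delta> / 2)\<close> unfolding atLeastAtMost_iff by linarith
      then show ?thesis
        unfolding P_def using \<open>L \<ge> 0\<close> by (intro exI[of _ L] conjI ballI bound) auto
    qed
    then show ?case using e(1) C(2) by (intro exI[of _ "min e (\<delta> / 2)"]) auto
  qed
  then show ?thesis unfolding P_def by auto
qed

text \<open>A discrete product rule. Increments and remainders of \<open>f\<close> act on
  \<open>\<alpha> s\<close> and \<open>\<alpha>' s\<close>, which is where the uniform bound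
  \<open>K\<close> on the one-form enters.\<close>

lemma mult_along_in_CRP_along:
  fixes A :: "('m::{t2_space,second_countable_topology}, 'e::{real_normed_vector,heine_borel}) chart set"
    and \<alpha> :: "real \<Rightarrow> 'e \<Rightarrow>\<^sub>L 'v::real_normed_vector"
    and f :: "real \<Rightarrow> 'v \<Rightarrow>\<^sub>L 'u::real_normed_vector"
  assumes X: "weak_geometric_rough_path X"
    and A: "smooth_atlas A" and g: "riemannian_metric A g" and G: "is_gauge A G"
    and y: "continuous_on {0..rpT X} y" and \<alpha>: "(\<alpha>, \<alpha>') \<in> CRP_along X g G y"
    and f: "(f, f') \<in> CRP X"
  shows "mult_along X (f, f') (\<alpha>, \<alpha>') \<in> CRP_along X g G y"
proof -
  let ?T = "rpT X"
  have N: "norm_like (rnorm g m)" for m by (rule norm_like_rnorm[OF A g])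
  obtain C \<delta> where C: "0 \<le> C" "0 < \<delta>" and est: "\<And>s t. \<lbrakk>0 \<le> s; s \<le> t; t \<le> ?T; t - s \<le> \<delta>\<rbrakk>
      \<Longrightarrow> one_form_estimate X g G y C \<alpha> \<alpha>' s t"
    using \<alpha> unfolding CRP_along_iff[OF N] by blast
  obtain K where K: "0 \<le> K" "\<And>s. \<lbrakk>0 \<le> s; s \<le> ?T\<rbrakk> \<Longrightarrow> one_form_bound g y K \<alpha> \<alpha>' s"
    using CRP_along_bounded[OF X A g G y \<alpha>] by blast
  obtain D where D: "0 \<le> D"
    "\<And>s. \<lbrakk>0 \<le> s; s \<le> rpT X\<rbrakk> \<Longrightarrow> norm (f s) \<le> D"
    "\<And>s. \<lbrakk>0 \<le> s; s \<le> rpT X\<rbrakk> \<Longrightarrow> norm (f' s) \<le> D"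
    "\<And>s t. \<lbrakk>0 \<le> s; s \<le> t; t \<le> rpT X\<rbrakk>
      \<Longrightarrow> norm (f t - f s - f' s (rpx X t - rpx X s)) \<le> D * (rho X s t)\<^sup>2"
    "\<And>s t. \<lbrakk>0 \<le> s; s \<le> t; t \<le> rpT X\<rbrakk> \<Longrightarrow> norm (f t - f s) \<le> D * rho X s t"
    "\<And>s t. \<lbrakk>0 \<le> s; s \<le> t; t \<le> rpT X\<rbrakk> \<Longrightarrow> norm (f' t - f' s) \<le> D * rho X s t"
    using CRP_bounds[OF X f] by blast
  have app: "norm (L v) \<le> a * b" if "norm L \<le> a" "norm v \<le> b"
    for L :: "'x::real_normed_vector \<Rightarrow>\<^sub>L 'y::real_normed_vector" and v a b
    using that by (intro order_trans[OF norm_blinfun] mult_mono) (auto intro: order_trans[OF norm_ge_zero])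
  define R where "R = rho X 0 ?T"
  define h where "h = (\<lambda>s\<in>{0..?T}. f s o\<^sub>L \<alpha> s)"
  define h' where "h' = (\<lambda>s\<in>{0..?T}. pre_comp (f' s) (\<alpha> s) + post_comp (f s) (\<alpha>' s))"
  \<comment> \<open>Large enough for both relations, which require
    \<open>D * C + 2 * (D * K)\<close> and \<open>D * C * (1 + R) + 3 * (D * K)\<close>.\<close>
  define E where "E = D * C * (1 + R) + 4 * (D * K)"
  have R0: "0 \<le> R" by (simp add: R_def)
  have E0: "0 \<le> E" using D(1) C(1) K(1) R0 by (simp add: E_def)
  have "one_form_estimate X g G y E h h' s t" if st: "0 \<le> s" "s \<le> t" "t \<le> ?T" "t - s \<le> \<delta>" for s t
  proof -
    let ?U = "gpar G (y t) (y s)" and ?N = "rnorm g (y s)" and ?x = "rpx X t - rpx X s" and ?r = "rho X s t"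
    have s: "0 \<le> s" "s \<le> ?T" and t: "0 \<le> t" "t \<le> ?T" using st by auto
    have N0: "0 \<le> ?N v" for v by (rule norm_like_nonneg[OF N])
    have r: "?r \<le> R" using st rho_mono[OF X, of 0 s t ?T] by (auto simp: R_def)
    have x: "norm ?x \<le> ?r" by (rule norm_increment_le(1)[OF X st(1-3)])
    have e1: "norm (\<alpha> t (?U v) - \<alpha> s v - \<alpha>' s ?x v) \<le> C * ?r\<^sup>2 * ?N v"
      and e2: "norm (\<alpha>' t w (?U v) - \<alpha>' s w v) \<le> C * ?r * norm w * ?N v"
      and ok: "(y t, y s) \<in> gdom G" for w v
      using est[OF st] by (auto simp: one_form_estimate_def)
    have b1: "norm (\<alpha> s v) \<le> K * ?N v" and b2: "norm (\<alpha>' s w v) \<le> K * norm w * ?N v" for w v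
      using K(2)[OF s] by (auto simp: one_form_bound_def)
    have b2x: "norm (\<alpha>' s ?x v) \<le> K * ?r * ?N v" for v
      using x K(1) N0 by (intro order_trans[OF b2] mult_right_mono mult_left_mono) auto
    have e3: "norm (\<alpha> t (?U v) - \<alpha> s v) \<le> C * ?r\<^sup>2 * ?N v + K * ?r * ?N v" for v
      using norm_triangle_ineq[of "\<alpha> t (?U v) - \<alpha> s v - \<alpha>' s ?x v" "\<alpha>' s ?x v"] e1[of v] b2x[of v] by simp
    have "norm (h t (?U v) - h s v - h' s ?x v) \<le> E * ?r\<^sup>2 * ?N v" for v
    proof -
      have "h t (?U v) - h s v - h' s ?x v = f t (\<alpha> t (?U v) - \<alpha> s v - \<alpha>' s ?x v)
          + (f t - f s - f' s ?x) (\<alpha> s v) + (f t - f s) (\<alpha>' s ?x v)"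
        using s t by (simp add: h_def h'_def blinfun.diff_left blinfun.diff_right blinfun.add_left)
      also have "norm \<dots> \<le> D * (C * ?r\<^sup>2 * ?N v) + (D * ?r\<^sup>2) * (K * ?N v) + (D * ?r) * (K * ?r * ?N v)"
        by (intro norm_triangle_mono app D(2,4,5) e1 b1 b2x st t)
      also have "\<dots> = (D * C + 2 * (D * K)) * ?r\<^sup>2 * ?N v" by (simp add: power2_eq_square algebra_simps)
      also have "\<dots> \<le> E * ?r\<^sup>2 * ?N v"
        using D(1) C(1) K(1) R0 N0[of v] unfolding E_def
        by (intro mult_right_mono) (auto simp: distrib_left)
      finally show ?thesis .
    qed
    moreover have "norm (h' t w (?U v) - h' s w v) \<le> E * ?r * norm w * ?N v" for w v
    proof -
      \<comment> \<open>Each of the two products in \<open>h'\<close> is split into increments of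
        its factors. The increment of \<open>\<alpha>\<close> contributes a first-order part through
        \<open>\<alpha>' s\<close> and a remainder of order two, whence the factor
        \<open>1 + rho\<close> below.\<close>
      have "h' t w (?U v) - h' s w v = f' t w (\<alpha> t (?U v) - \<alpha> s v) + (f' t - f' s) w (\<alpha> s v)
          + f t (\<alpha>' t w (?U v) - \<alpha>' s w v) + (f t - f s) (\<alpha>' s w v)"
        using s t by (simp add: h'_def blinfun.diff_left blinfun.diff_right blinfun.add_left)
      also have "norm \<dots> \<le> (D * norm w) * (C * ?r\<^sup>2 * ?N v + K * ?r * ?N v)
          + (D * ?r * norm w) * (K * ?N v)
          + D * (C * ?r * norm w * ?N v) + (D * ?r) * (K * norm w * ?N v)"
        by (intro norm_triangle_mono app D(2,3,5,6) e2 e3 b1 b2 st t order_refl)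
      also have "\<dots> = (D * C * (1 + ?r) + 3 * (D * K)) * (?r * norm w * ?N v)"
        by (simp add: power2_eq_square algebra_simps)
      also have "\<dots> \<le> E * (?r * norm w * ?N v)"
        using D(1) C(1) K(1) N0[of v] r unfolding E_def
        by (intro mult_right_mono add_mono mult_left_mono) auto
      finally show ?thesis by (simp add: mult.assoc)
    qed
    ultimately show ?thesis using ok by (simp add: one_form_estimate_def)
  qed
  then have "(h, h') \<in> CRP_along X g G y"
    unfolding CRP_along_iff[OF N] using E0 C(2) by (auto simp: h_def h'_def)
  then show ?thesis by (simp add: h_def h'_def)
qed

theorem theorem3p24:
  fixes X :: "('k::finite) rough_path"
    and A :: "('m::{t2_space,second_countable_topology}, 'e::{real_normed_vector,heine_borel}) chart set"
    and g :: "'m \<Rightarrow> 'e \<Rightarrow> 'e \<Rightarrow> real"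
    and G :: "('m, 'e) gauge"
    and y :: "real \<Rightarrow> 'm" and y' :: "real \<Rightarrow> (real^'k) \<Rightarrow>\<^sub>L 'e"
    and \<alpha> :: "real \<Rightarrow> 'e \<Rightarrow>\<^sub>L 'v::banach" and \<alpha>' :: "real \<Rightarrow> (real^'k) \<Rightarrow>\<^sub>L ('e \<Rightarrow>\<^sub>L 'v)"
    and f :: "real \<Rightarrow> 'v \<Rightarrow>\<^sub>L 'u::banach" and f' :: "real \<Rightarrow> (real^'k) \<Rightarrow>\<^sub>L ('v \<Rightarrow>\<^sub>L 'u)"
    and z :: "real \<Rightarrow> 'v" and z' :: "real \<Rightarrow> (real^'k) \<Rightarrow>\<^sub>L 'v"
  assumes "weak_geometric_rough_path X"
    and "smooth_atlas A" and "riemannian_metric A g" and "is_gauge A G"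
    and "(y, y') \<in> CRP_mfd X A g G"
    and "(\<alpha>, \<alpha>') \<in> CRP_along X g G y"
    and "(f, f') \<in> CRP X"
    and "is_gauge_integral X A G (y, y') (\<alpha>, \<alpha>') (z, z')"
  shows "mult_along X (f, f') (\<alpha>, \<alpha>') \<in> CRP_along X g G y \<and>
         (\<exists>!\<q>. is_flat_integral X (f, f') (z, z') \<q>) \<and>
         (\<exists>!\<q>. is_gauge_integral X A G (y, y') (mult_along X (f, f') (\<alpha>, \<alpha>')) \<q>) \<and>
         flat_integral X (f, f') (z, z') =
           gauge_integral X A G (y, y') (mult_along X (f, f') (\<alpha>, \<alpha>'))"
proof -
  have y: "continuous_on {0..rpT X} y" using assms(5) by (simp add: CRP_mfd_def)
  have z: "(z, z') \<in> CRP X" using assms(8) by simp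
  have ex1: "\<exists>!q. is_flat_integral X (f, f') (z, z') q"
    using flat_integral_exists[OF assms(1,7) z] flat_integral_unique[OF assms(1)] by fast
  \<comment> \<open>Equality of the predicates themselves transfers unique existence to the gauge
    side and identifies the two definite descriptions.\<close>
  moreover have "is_flat_integral X (f, f') (z, z') =
      is_gauge_integral X A G (y, y') (mult_along X (f, f') (\<alpha>, \<alpha>'))"
    by (rule ext) (rule flat_integral_iff_gauge_integral[OF assms(1,7,8)])
  ultimately show ?thesis
    using mult_along_in_CRP_along[OF assms(1-4) y assms(6,7)]
    by (simp add: flat_integral_def gauge_integral_def)
qed

end
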